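(* Let $p>32$ be a prime and let $X,Y$ be subsets of $\mathbb{Z}/p\mathbb{Z}$ such that $$|X+Y|=|X|+|Y|+1\le p-5,$$ with $|Y|\ge 4$ and $|X|\ge 5$. If $\ell_1(Y)\le |Y|+2$, then $\ell_1(X)\le |X|+2$.
   Context: For a subset $Z$ of $\mathbb{Z}/p\mathbb{Z}$ and $r\in\mathbb{Z}/p\mathbb{Z}$, $\ell_r(Z)$ denotes the cardinality of the smallest arithmetic progression with difference $r$ containing $Z$. *)

theory Defs
  imports "HOL-Number_Theory.Residues" "HOL-Algebra.AbelCoset"
begin

text \<open>Arithmetic progressions in the additive group of a ring, given by first term, difference
  and number of terms. The terms may repeat (if the progression wraps around), so the number of
  terms need not be the cardinality.\<close>

definition arith_prog :: "('a, 'b) ring_scheme \<Rightarrow> 'a \<Rightarrow> 'a \<Rightarrow> nat \<Rightarrow> 'a set" where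
  "arith_prog R a r k = {a \<oplus>\<^bsub>R\<^esub> ([i] \<cdot>\<^bsub>R\<^esub> r) | i::nat. i < k}"

text \<open>The quantity \<open>\<ell>\<^sub>r(Z)\<close>. The minimum is over a nonempty set whenever \<open>r\<close> generates the
  additive group, as every nonzero \<open>r\<close> does in \<open>\<int>/p\<int>\<close>; if no progression with difference \<open>r\<close>
  contains \<open>Z\<close> (for example \<open>r = 0\<close> and \<open>Z\<close> with two elements) the value is meaningless.\<close>

definition ap_len :: "('a, 'b) ring_scheme \<Rightarrow> 'a \<Rightarrow> 'a set \<Rightarrow> nat" where
  "ap_len R r Z = (LEAST n. \<exists>a\<in>carrier R. \<exists>k. Z \<subseteq> arith_prog R a r k \<and> card (arith_prog R a r k) = n)"

end

theory Submission
  imports Defs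
begin

text \<open>
  Up to translation, \<open>Y\<close> is an integer interval \<open>{0..m}\<close> with at most two interior elements
  (\<open>holes\<close>) removed. Lift \<open>X\<close> to an \<open>n\<close>-periodic set of integers, \<open>n = p\<close>, and let \<open>Z\<close> be the complement
  of the sumset: an element of \<open>Z\<close> that follows some \<open>x \<in> X\<close> at distance at most \<open>m\<close> does so
  at a distance which is a hole of \<open>Y\<close>, and at most \<open>m + 2\<close> residues lie in neither \<open>X\<close> nor \<open>Z\<close>.

  If the window \<open>[z - m, z]\<close> of some \<open>z \<in> Z\<close> misses \<open>X\<close>, no sum wraps around, and the claim is a
  statement on finite sets of integers. If the window \<open>[x, x + m]\<close> of some \<open>x \<in> X\<close> misses \<open>Z\<close>, then exchanging the
  roles of \<open>X\<close> and \<open>-Z\<close> leads to the first case for \<open>Z\<close>, so \<open>Z\<close> is almost an interval and the window of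
  one of its middle elements misses \<open>X\<close>. Otherwise every window is hit; then \<open>X\<close> and \<open>Z\<close> form short
  alternating blocks, most elements of each window lie in neither set, and double counting these
  elements over the windows of the first elements of the blocks of \<open>Z\<close> forces \<open>n \<le> 32\<close>.
\<close>

section \<open>Sumsets of finite sets of integers\<close>

definition sumset :: "int set \<Rightarrow> int set \<Rightarrow> int set" where
  "sumset A B = {x + y | x y. x \<in> A \<and> y \<in> B}"

lemma sumsetI: "x \<in> A \<Longrightarrow> y \<in> B \<Longrightarrow> x + y \<in> sumset A B"
  by (auto simp: sumset_def)

lemma sumset_memI: "x \<in> A \<Longrightarrow> s - x \<in> B \<Longrightarrow> s \<in> sumset A B"
  using sumsetI[of x A "s - x" B] by simp

lemma finite_sumset: "finite A \<Longrightarrow> finite B \<Longrightarrow> finite (sumset A B)"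
  using finite_image_set2[of "\<lambda>x. x \<in> A" "\<lambda>y. y \<in> B" "\<lambda>x y. x + y"] by (simp add: sumset_def)

text \<open>The sums below \<open>c\<close>, those of the run \<open>{c..c + r}\<close> alone, and those above \<open>c + r + m\<close> are disjoint
  families; below, \<open>X\<close> itself is contained in the sumset, and above, \<open>X + m\<close>.\<close>
lemma sumset_run:
  fixes X Y :: "int set"
  assumes "finite X" and Y: "Y \<subseteq> {0..m}" "0 \<in> Y" "m \<in> Y" and run: "{c..c+r} \<subseteq> X" and r: "0 \<le> r"
  shows "card X + card (sumset {0..r} Y) + card {s \<in> sumset X Y. s < c \<and> s \<notin> X}
           + card {t. c + r < t \<and> t \<notin> X \<and> t + m \<in> sumset X Y}
         \<le> card (sumset X Y) + nat (r + 1)"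
proof -
  let ?S = "sumset X Y"
  have finY: "finite Y" using Y(1) finite_subset by blast
  have finS: "finite ?S" using assms(1) finY by (rule finite_sumset)
  let ?L = "{s \<in> ?S. s < c}" let ?M = "(\<lambda>s. s + c) ` sumset {0..r} Y" let ?R = "{s \<in> ?S. c + r + m < s}"
  let ?D1 = "{s \<in> ?S. s < c \<and> s \<notin> X}" let ?D2 = "{t. c + r < t \<and> t \<notin> X \<and> t + m \<in> ?S}"
  let ?X1 = "{x \<in> X. x < c}" let ?X2 = "{x \<in> X. c + r < x}"
  have Msub: "?M \<subseteq> {s \<in> ?S. c \<le> s \<and> s \<le> c + r + m}"
  proof
    fix s assume "s \<in> ?M"
    then obtain i y where iy: "s = i + y + c" "0 \<le> i" "i \<le> r" "y \<in> Y" by (auto simp: sumset_def)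
    have "c + i \<in> X" using run iy by auto
    then have "(c + i) + y \<in> ?S" using iy by (intro sumsetI)
    moreover have "0 \<le> y \<and> y \<le> m" using iy Y by auto
    ultimately show "s \<in> {s \<in> ?S. c \<le> s \<and> s \<le> c + r + m}" using iy by (auto simp: algebra_simps)
  qed
  have cM: "card ?M = card (sumset {0..r} Y)" by (rule card_image) (auto simp: inj_on_def)
  have finM: "finite ?M" by (intro finite_imageI finite_sumset finY) auto
  have XS: "X \<subseteq> ?S" using Y(2) sumsetI[of _ X 0 Y] by auto
  have XmS: "x + m \<in> ?S" if "x \<in> X" for x using that Y(3) by (rule sumsetI)
  have "?L = ?X1 \<union> ?D1" using XS by auto
  then have cL: "card ?L = card ?X1 + card ?D1"
    using assms(1) finS by (simp add: card_Un_disjoint disjoint_iff)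
  have R: "(\<lambda>t. t + m) ` (?X2 \<union> ?D2) \<subseteq> ?R" using XmS by auto
  have finXD: "finite ((\<lambda>t. t + m) ` (?X2 \<union> ?D2))" by (rule finite_subset[OF R]) (use finS in auto)
  then have finXD': "finite (?X2 \<union> ?D2)" by (rule finite_imageD) (auto simp: inj_on_def)
  have "card (?X2 \<union> ?D2) = card ((\<lambda>t. t + m) ` (?X2 \<union> ?D2))" by (rule card_image[symmetric]) (auto simp: inj_on_def)
  also have "\<dots> \<le> card ?R" by (rule card_mono) (use finS R in auto)
  finally have "card (?X2 \<union> ?D2) \<le> card ?R" .
  moreover have "card (?X2 \<union> ?D2) = card ?X2 + card ?D2" by (rule card_Un_disjoint) (use finXD' in auto)
  ultimately have cR: "card ?X2 + card ?D2 \<le> card ?R" by simp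
  have "card (?L \<union> ?M \<union> ?R) = card (?L \<union> ?M) + card ?R"
  proof (rule card_Un_disjoint)
    have "s \<le> c + r + m" if "s \<in> ?L" for s using that r Y by auto
    then show "(?L \<union> ?M) \<inter> ?R = {}" using Msub by fastforce
  qed (use finS finM in auto)
  also have "card (?L \<union> ?M) = card ?L + card ?M"
    by (rule card_Un_disjoint) (use finS finM Msub in auto)
  finally have "card ?L + card ?M + card ?R = card (?L \<union> ?M \<union> ?R)" by simp
  also have "\<dots> \<le> card ?S" by (rule card_mono) (use finS Msub in auto)
  finally have tot: "card ?L + card ?M + card ?R \<le> card ?S" .
  have "X = ?X1 \<union> {c..c+r} \<union> ?X2" using run by auto
  then have "card X = card (?X1 \<union> {c..c+r} \<union> ?X2)" by simp
  also have "\<dots> = card (?X1 \<union> {c..c+r}) + card ?X2"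
    by (rule card_Un_disjoint) (use assms(1) r in auto)
  also have "card (?X1 \<union> {c..c+r}) = card ?X1 + card {c..c+r}"
    by (rule card_Un_disjoint) (use assms(1) in auto)
  also have "card {c..c+r} = nat (r + 1)" by simp
  finally have "card X = card ?X1 + nat (r + 1) + card ?X2" .
  then show ?thesis using tot cL cR cM by linarith
qed

section \<open>Integer sets of large diameter with a small sumset\<close>

lemma int_pred:
  fixes X :: "int set"
  assumes "finite X" "x \<in> X" "x < u"
  obtains e where "e \<in> X" "e < u" "\<And>v. e < v \<Longrightarrow> v < u \<Longrightarrow> v \<notin> X"
proof -
  let ?A = "{y \<in> X. y < u}"
  have f: "finite ?A" "?A \<noteq> {}" using assms by auto
  show thesis
  proof (rule that)
    show "Max ?A \<in> X" "Max ?A < u" using Max_in[OF f] by auto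
    show "v \<notin> X" if "Max ?A < v" "v < u" for v
      using Max_ge[OF f(1), of v] that by auto
  qed
qed

lemma int_succ:
  fixes X :: "int set"
  assumes "finite X" "x \<in> X" "u < x"
  obtains f where "f \<in> X" "u < f" "\<And>v. u < v \<Longrightarrow> v < f \<Longrightarrow> v \<notin> X"
proof -
  let ?A = "{y \<in> X. u < y}"
  have f: "finite ?A" "?A \<noteq> {}" using assms by auto
  show thesis
  proof (rule that)
    show "Min ?A \<in> X" "u < Min ?A" using Min_in[OF f] by auto
    show "v \<notin> X" if "u < v" "v < Min ?A" for v
      using Min_le[OF f(1), of v] that by auto
  qed
qed

lemma card_le_1I:
  assumes "finite A" "card A \<le> 1" "x \<in> A" "y \<in> A"
  shows "x = y"
  using assms by (metis card_le_Suc0_iff_eq One_nat_def)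

text \<open>This is set up for contradiction. By \<open>wide\<close>, \<open>X\<close> does not fit
  into an interval of \<open>card X + 2\<close> integers, so at least three gaps lie between
  \<open>lo\<close> and \<open>hi\<close>. By \<open>small\<close>, the sumset exceeds the minimum
  \<open>card X + card Y - 1\<close> by at most two.\<close>

locale wide_summand =
  fixes X Y :: "int set" and m :: int
  assumes fin: "finite X" and X5: "5 \<le> card X" and Ysub: "Y \<subseteq> {0..m}" and Y0: "0 \<in> Y" and Ym: "m \<in> Y"
    and small: "card (sumset X Y) \<le> card X + card Y + 1"
    and wide: "int (card X) + 1 < Max X - Min X"
begin

abbreviation "S \<equiv> sumset X Y"
abbreviation "lo \<equiv> Min X"
abbreviation "hi \<equiv> Max X"
definition "gaps = {lo..hi} - X"
text \<open>The sumset contains both \<open>X\<close> and \<open>X + m\<close>. New sums are those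
  that neither copy explains: \<open>left_new\<close> collects sums below \<open>c\<close> outside
  \<open>X\<close>, \<open>right_new\<close> those above \<open>c + m\<close> outside
  \<open>X + m\<close>, shifted back by \<open>m\<close>.\<close>

definition "left_new c = {s \<in> S. s < c \<and> s \<notin> X}"
definition "right_new c = {t. c < t \<and> t \<notin> X \<and> t + m \<in> S}"

lemma finY: "finite Y" using Ysub finite_subset by blast
lemma finS: "finite S" using fin finY by (rule finite_sumset)
lemma fin_gaps: "finite gaps" by (simp add: gaps_def)
lemma fin_left_new: "finite (left_new c)" using finS by (simp add: left_new_def)
lemma fin_right_new: "finite (right_new c)"
proof (rule finite_subset)
  show "right_new c \<subseteq> (\<lambda>s. s - m) ` S" by (force simp: right_new_def image_iff)
qed (use finS in auto)

lemma ne: "X \<noteq> {}" using X5 by auto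
lemma lo: "lo \<in> X" and hi: "hi \<in> X" using fin ne by auto
lemma lo_le: "x \<in> X \<Longrightarrow> lo \<le> x" and hi_ge: "x \<in> X \<Longrightarrow> x \<le> hi" using fin by auto

lemma card_gaps_ge: "3 \<le> card gaps"
proof -
  have "card gaps = card {lo..hi} - card X"
    unfolding gaps_def using fin lo_le hi_ge by (intro card_Diff_subset) auto
  then show ?thesis using wide by simp
qed

lemma gaps_iff: "u \<in> gaps \<longleftrightarrow> lo < u \<and> u < hi \<and> u \<notin> X"
  using lo hi by (auto simp: gaps_def less_le)

lemma in_SI: "x \<in> X \<Longrightarrow> s - x \<in> Y \<Longrightarrow> s \<in> S" by (rule sumset_memI)

lemma gaps_pred:
  assumes "u \<in> gaps"
  obtains e where "e \<in> X" "e < u" "\<And>v. e < v \<Longrightarrow> v \<le> u \<Longrightarrow> v \<in> gaps"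
proof -
  have u: "lo < u" "u < hi" "u \<notin> X" using assms gaps_iff by auto
  obtain e where e: "e \<in> X" "e < u" "\<And>v. e < v \<Longrightarrow> v < u \<Longrightarrow> v \<notin> X"
    using int_pred[OF fin lo u(1)] by blast
  show thesis
  proof (rule that[OF e(1,2)])
    fix v assume "e < v" "v \<le> u"
    then show "v \<in> gaps" using e lo_le[OF e(1)] u by (cases "v = u") (auto simp: gaps_iff)
  qed
qed

lemma gaps_succ:
  assumes "u \<in> gaps"
  obtains f where "f \<in> X" "u < f" "\<And>v. u \<le> v \<Longrightarrow> v < f \<Longrightarrow> v \<in> gaps"
proof -
  have u: "lo < u" "u < hi" "u \<notin> X" using assms gaps_iff by auto
  obtain f where f: "f \<in> X" "u < f" "\<And>v. u < v \<Longrightarrow> v < f \<Longrightarrow> v \<notin> X"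
    using int_succ[OF fin hi u(2)] by blast
  show thesis
  proof (rule that[OF f(1,2)])
    fix v assume "u \<le> v" "v < f"
    then show "v \<in> gaps" using f hi_ge[OF f(1)] u by (cases "v = u") (auto simp: gaps_iff)
  qed
qed

lemma new_run:
  assumes "{c..c+r} \<subseteq> X" "0 \<le> r"
  shows "card (sumset {0..r} Y) + card (left_new c) + card (right_new (c + r)) \<le> card Y + nat (r + 2)"
  using sumset_run[OF fin Ysub Y0 Ym assms] small assms(2) unfolding left_new_def right_new_def by linarith

text \<open>A run of one element contributes exactly \<open>card Y\<close> sums, so
  \<open>new_run\<close> leaves room for two new ones.\<close>

lemma new_point:
  assumes "c \<in> X"
  shows "card (left_new c) + card (right_new c) \<le> 2"
proof -
  have "sumset {0..0} Y = Y" by (auto simp: sumset_def)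
  then show ?thesis using new_run[of c 0] assms by simp
qed

lemma card_gaps_S: "card (gaps \<inter> S) \<le> 2"
proof -
  have "card (gaps \<inter> S) \<le> card (left_new hi)"
    by (rule card_mono[OF fin_left_new]) (auto simp: left_new_def gaps_iff)
  then show ?thesis using new_point[OF hi] by simp
qed

text \<open>There are at least three gaps, and at most two of them are sums. Several contradictions
  arise by showing that every gap is a sum.\<close>

lemma gaps_not_sub_S: "\<not> gaps \<subseteq> S"
  using card_gaps_S card_gaps_ge by (auto simp: Int_absorb2)

text \<open>A long stretch of gaps after \<open>e\<close> would contain three elements of
  \<open>e + Y\<close>, one more than the number of gaps that can be sums.\<close>

lemma far_dots:
  assumes "e \<in> X" "i \<in> Y" "j \<in> Y" "k \<in> Y" "0 < i" "i < j" "j < k" "\<And>v. e < v \<Longrightarrow> v \<le> e + k \<Longrightarrow> v \<in> gaps"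
  shows False
proof -
  have "{e + i, e + j, e + k} \<subseteq> gaps \<inter> S" using assms by (auto intro: sumsetI)
  then have "card {e + i, e + j, e + k} \<le> card (gaps \<inter> S)" using fin_gaps by (intro card_mono) auto
  then show False using card_gaps_S assms by simp
qed

end

text \<open>Every gap is within \<open>m\<close> of its predecessor \<open>e\<close> in
  \<open>X\<close>, since otherwise \<open>e + 1\<close>, \<open>e + 2\<close>, \<open>e + 3\<close>
  are three gaps in the sumset. Hence the full intervals \<open>e + Y\<close> cover all
  gaps.\<close>

lemma no_wide_full:
  fixes m :: int
  assumes "wide_summand X {0..m} m" "3 \<le> m"
  shows False
proof -
  interpret wide_summand X "{0..m}" m by fact
  have "gaps \<subseteq> S"
  proof
    fix u assume u: "u \<in> gaps"
    then obtain e where e: "e \<in> X" "e < u" "\<And>v. e < v \<Longrightarrow> v \<le> u \<Longrightarrow> v \<in> gaps" using gaps_pred by blast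
    have "u \<le> e + m"
      using far_dots[OF e(1), of 1 2 3] e(3) assms(2) by force
    then show "u \<in> S" using e by (intro in_SI[of e]) auto
  qed
  then show False using gaps_not_sub_S by blast
qed

section \<open>Summands that are intervals with one or two holes\<close>

lemma card_interval_holes:
  fixes a b m :: int
  assumes "0 < a" "a \<le> b" "b < m"
  shows "int (card ({0..m} - {a, b})) = m + 1 - (if a = b then 1 else 2)"
proof -
  have "card ({0..m} - {a, b}) = card {0..m} - card {a, b}" using assms by (intro card_Diff_subset) auto
  moreover have "card {a,b} = (if a = b then 1 else 2)" by auto
  ultimately show ?thesis using assms by auto
qed

text \<open>A single hole is the case \<open>a = b\<close>. The orientation is fixed by
  \<open>ref\<close>: reflecting \<open>Y\<close> exchanges the distances \<open>a\<close> and
  \<open>m - b\<close> of the outermost holes from the ends.\<close>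

locale wide_holes = wide_summand +
  fixes a b :: int
  assumes Ydef: "Y = {0..m} - {a, b}" and ab: "0 < a" "a \<le> b" "b < m" and ref: "m - b \<le> a"
    and Y4: "4 \<le> card Y"
begin

lemma YI: "0 \<le> y \<Longrightarrow> y \<le> m \<Longrightarrow> y \<noteq> a \<Longrightarrow> y \<noteq> b \<Longrightarrow> y \<in> Y" using Ydef by auto

lemma cardY: "int (card Y) = m + 1 - (if a = b then 1 else 2)"
  unfolding Ydef using ab by (rule card_interval_holes)

lemma m_ge: "a = b \<Longrightarrow> 4 \<le> m" "a \<noteq> b \<Longrightarrow> 5 \<le> m" using cardY Y4 by auto

text \<open>Adding \<open>{0..1}\<close> to \<open>Y\<close> fills the hole \<open>a\<close> and
  adds \<open>m + 1\<close>, which takes two of the three extra sums that \<open>new_run\<close>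
  allows. If the holes are neither equal nor adjacent, \<open>b\<close> is filled from
  \<open>b - 1\<close> as well and nothing is left.\<close>

lemma new_pair:
  assumes "c \<in> X" "c + 1 \<in> X"
  shows new_pair_le: "card (left_new c) + card (right_new (c + 1)) \<le> 1"
    and new_pair_empty: "a + 2 \<le> b \<Longrightarrow> left_new c = {} \<and> right_new (c + 1) = {}"
proof -
  have r: "{c..c+1} \<subseteq> X"
  proof
    fix x assume "x \<in> {c..c+1}"
    then have "x = c \<or> x = c + 1" by auto
    then show "x \<in> X" using assms by auto
  qed
  let ?T = "sumset {0..1} Y"
  have finT: "finite ?T" using finY by (simp add: finite_sumset)
  have T: "s \<in> ?T" if "s \<in> Y \<or> s - 1 \<in> Y" for s
    using that sumset_memI[of 0 "{0..1}" s Y] sumset_memI[of 1 "{0..1}" s Y] by auto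
  have aT: "a \<in> ?T" using ab by (intro T disjI2 YI) auto
  have mT: "m + 1 \<in> ?T" using Ym by (intro T) auto
  have YT: "Y \<subseteq> ?T" using T by auto
  have aY: "a \<notin> Y" "b \<notin> Y" "m + 1 \<notin> Y" using Ydef by auto
  have D: "card ?T + card (left_new c) + card (right_new (c + 1)) \<le> card Y + 3"
    using new_run[OF r] by simp
  have "card (insert a (insert (m + 1) Y)) \<le> card ?T"
    using aT mT YT finT by (intro card_mono) auto
  moreover have "card (insert a (insert (m + 1) Y)) = card Y + 2" using aY ab finY by simp
  ultimately show "card (left_new c) + card (right_new (c + 1)) \<le> 1" using D by simp
  assume d: "a + 2 \<le> b"
  have "b \<in> ?T" using ab d by (intro T disjI2 YI) auto
  then have "card (insert b (insert a (insert (m + 1) Y))) \<le> card ?T"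
    using aT mT YT finT by (intro card_mono) auto
  moreover have "card (insert b (insert a (insert (m + 1) Y))) = card Y + 3" using aY ab d finY by simp
  ultimately have "card (left_new c) + card (right_new (c + 1)) \<le> 0" using D by simp
  then show "left_new c = {} \<and> right_new (c + 1) = {}" using fin_left_new fin_right_new by simp
qed

text \<open>Three consecutive elements fill both holes and add \<open>m + 1\<close> and
  \<open>m + 2\<close>, which exhausts the bound of \<open>new_run\<close>.\<close>

lemma new_triple:
  assumes "c \<in> X" "c + 1 \<in> X" "c + 2 \<in> X" "a < b"
  shows "left_new c = {} \<and> right_new (c + 2) = {}"
proof -
  have r: "{c..c+2} \<subseteq> X"
  proof
    fix x assume "x \<in> {c..c+2}"
    then have "x = c \<or> x = c + 1 \<or> x = c + 2" by auto
    then show "x \<in> X" using assms by auto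
  qed
  let ?T = "sumset {0..2} Y"
  have finT: "finite ?T" using finY by (simp add: finite_sumset)
  have T: "s \<in> ?T" if "s \<in> Y \<or> s - 1 \<in> Y \<or> s - 2 \<in> Y" for s
    using that sumset_memI[of 0 "{0..2}" s Y] sumset_memI[of 1 "{0..2}" s Y] sumset_memI[of 2 "{0..2}" s Y] by auto
  have "a \<in> ?T" using ab by (intro T disjI2 disjI1 YI) auto
  moreover have "b \<in> ?T"
  proof (cases "b - 1 = a")
    case True
    \<comment> \<open>With adjacent holes \<open>b - 1\<close> is the hole \<open>a\<close>, so
      \<open>b\<close> is reached from \<open>b - 2 = a - 1\<close>.\<close>
    have "b - 2 \<in> Y" using ab True by (intro YI) auto
    then show ?thesis by (intro T) auto
  next
    case False
    have "b - 1 \<in> Y" using ab False by (intro YI) auto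
    then show ?thesis by (intro T) auto
  qed
  moreover have "m + 1 \<in> ?T" "m + 2 \<in> ?T" using Ym by (auto intro: T)
  moreover have "Y \<subseteq> ?T" using T by auto
  ultimately have "card (insert b (insert a (insert (m + 2) (insert (m + 1) Y)))) \<le> card ?T"
    using finT by (intro card_mono) auto
  moreover have "a \<notin> Y" "b \<notin> Y" "m + 1 \<notin> Y" "m + 2 \<notin> Y" using Ydef by auto
  then have "card (insert b (insert a (insert (m + 2) (insert (m + 1) Y)))) = card Y + 4"
    using ab assms(4) finY by simp
  ultimately have "card (left_new c) + card (right_new (c + 2)) \<le> 0" using new_run[OF r] by simp
  then show ?thesis using fin_left_new fin_right_new by simp
qed

lemma left_newI: "s \<in> gaps \<Longrightarrow> s < c \<Longrightarrow> s \<in> S \<Longrightarrow> s \<in> left_new c" by (auto simp: left_new_def gaps_iff)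
lemma right_newI: "t \<in> gaps \<Longrightarrow> c < t \<Longrightarrow> t + m \<in> S \<Longrightarrow> t \<in> right_new c" by (auto simp: right_new_def gaps_iff)

text \<open>Here \<open>m - 1\<close> lies in \<open>Y\<close>, so the last gap before the next
  element \<open>f\<close> of \<open>X\<close> is new from the right:
  \<open>f - 1 + m = f + (m - 1)\<close>.\<close>

lemma right_empty:
  assumes "right_new c = {}" "c \<in> X" "2 \<le> m - b" "u \<in> gaps" "c < u"
  shows False
proof -
  obtain f where f: "f \<in> X" "u < f" "\<And>v. u \<le> v \<Longrightarrow> v < f \<Longrightarrow> v \<in> gaps" using gaps_succ[OF assms(4)] by blast
  have "f - 1 + m \<in> S" using f(1) assms(3) ab by (intro in_SI[of f] YI) auto
  moreover have "f - 1 \<in> gaps" using f by auto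
  ultimately have "f - 1 \<in> right_new c" using f(2) assms(5) by (intro right_newI) auto
  then show False using assms(1) by auto
qed

text \<open>Since nothing to the right of \<open>c\<close> is new from the right, the gaps there are so short that they are filled
  from the left.\<close>
lemma right_filled:
  assumes "right_new c = {}" "c \<in> X" "m - b = 1" "a < b" "2 \<le> a" "u \<in> gaps" "c < u"
  shows "u \<in> S"
proof -
  have step: "v + 1 \<in> X \<or> a + 1 = b \<and> v + 2 \<in> X" if v: "v \<in> gaps" "c < v" for v
  proof -
    obtain f where f: "f \<in> X" "v < f" "\<And>w. v \<le> w \<Longrightarrow> w < f \<Longrightarrow> w \<in> gaps" using gaps_succ[OF v(1)] by blast
    have no: "i = 1 \<or> a + 1 = b \<and> i = 2" if i: "1 \<le> i" "i \<le> 2 \<or> a + 1 = b \<and> i = 3" "v \<le> f - i" for i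
    proof (rule ccontr)
      assume c: "\<not> ?thesis"
      have "f - i + m \<in> S" using f(1) i c assms ab m_ge(2) by (intro in_SI[of f] YI) auto
      moreover have "f - i \<in> gaps" using f i by auto
      ultimately have "f - i \<in> right_new c" using i \<open>c < v\<close> by (intro right_newI) auto
      then show False using assms(1) by auto
    qed
    have "f \<le> v + 2" using no[of 2] no[of 3] by (cases "v \<le> f - 3") auto
    then have "f = v + 1 \<or> f = v + 2" using f(2) by auto
    then show ?thesis using f(1) no[of 2] by auto
  qed
  obtain e where e: "e \<in> X" "e < u" "\<And>v. e < v \<Longrightarrow> v \<le> u \<Longrightarrow> v \<in> gaps" using gaps_pred[OF assms(6)] by blast
  have ce: "c \<le> e" using e(3)[of c] assms(2,7) by (force simp: gaps_iff)
  have s: "e + 2 \<in> X \<or> a + 1 = b \<and> e + 3 \<in> X"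
    using step[of "e + 1"] e ce by (auto simp: add.assoc)
  then have "e + 3 > u" using e(3)[of "e+2"] e(3)[of "e+3"] by (force simp: gaps_iff)
  then have "u = e + 1 \<or> u = e + 2" using e(2) by auto
  then show ?thesis
  proof
    assume "u = e + 1" then show ?thesis using e(1) assms ab by (intro in_SI[of e] YI) auto
  next
    assume u: "u = e + 2"
    then have "a + 1 = b" using s e(3)[of "e+2"] by (auto simp: gaps_iff)
    then show ?thesis using u e(1) assms ab m_ge(2) by (intro in_SI[of e] YI) auto
  qed
qed

definition "paired = {x \<in> X. x + 1 \<in> X}"

lemma gap_after_unpaired:
  assumes "x \<in> X" "x \<notin> paired" "x < y" "y \<in> X" "2 \<le> a"
  shows "x + 1 \<in> gaps \<inter> S" "x + 1 < y"
proof -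
  have "x + 1 \<notin> X" using assms(1,2) by (simp add: paired_def)
  moreover have "x + 1 \<le> y" using assms by simp
  moreover have "y \<noteq> x + 1" using \<open>x + 1 \<notin> X\<close> assms by auto
  ultimately show "x + 1 < y" by simp
  then have "x + 1 \<in> gaps" using lo_le[OF assms(1)] hi_ge[OF assms(4)] \<open>x + 1 \<notin> X\<close> by (auto simp: gaps_iff)
  moreover have "x + 1 \<in> S" using assms ab by (intro in_SI[of x] YI) auto
  ultimately show "x + 1 \<in> gaps \<inter> S" by simp
qed

text \<open>Since \<open>1 \<in> Y\<close>, each unpaired \<open>x\<close> other than
  \<open>hi\<close> gives the gap \<open>x + 1\<close> in the sumset, and distinct \<open>x\<close>
  give distinct gaps.\<close>

lemma card_paired:
  assumes "2 \<le> a"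
  shows "card X \<le> card paired + card (gaps \<inter> S) + 1"
proof -
  have "(\<lambda>x. x + 1) ` (X - paired - {hi}) \<subseteq> gaps \<inter> S"
    using gap_after_unpaired(1)[OF _ _ _ hi assms] hi_ge by (force simp: less_le)
  then have "card ((\<lambda>x. x + 1) ` (X - paired - {hi})) \<le> card (gaps \<inter> S)" using fin_gaps by (intro card_mono) auto
  moreover have "card ((\<lambda>x. x + 1) ` (X - paired - {hi})) = card (X - paired - {hi})"
    by (rule card_image) auto
  moreover have "card (X - paired) \<le> Suc (card (X - paired - {hi}))"
    using card_Diff_singleton_if[of "X - paired" hi] by (cases "card (X - paired)") auto
  moreover have "card (X - paired) = card X - card paired"
    using fin by (intro card_Diff_subset) (auto simp: paired_def intro: finite_subset)
  ultimately show ?thesis by linarith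
qed

lemma card_paired_ge: "2 \<le> a \<Longrightarrow> 2 \<le> card paired"
  using card_paired card_gaps_S X5 by fastforce

lemma fin_paired: "finite paired" using fin by (auto simp: paired_def)

text \<open>A gap that is not a sum lies exactly \<open>a\<close> after its predecessor. Relative to
  a pair \<open>c\<close>, \<open>c + 1\<close>, the stretch around such a gap produces new sums, of
  which only one is allowed. This forces \<open>a = 2\<close> and leaves at most two gaps.\<close>

lemma single_hole:
  assumes "a = b"
  shows False
proof -
  have a2: "2 \<le> a" and m4: "4 \<le> m" using ref m_ge assms by auto
  obtain c where c: "c \<in> X" "c + 1 \<in> X" using card_paired_ge[OF a2] by (metis (no_types, lifting) paired_def card.empty mem_Collect_eq not_numeral_le_zero ex_in_conv)
  note D = new_pair_le[OF c]
  have hole: "\<exists>e. e \<in> X \<and> u = e + a \<and> (\<forall>v. e < v \<longrightarrow> v \<le> u \<longrightarrow> v \<in> gaps)" if u: "u \<in> gaps" "u \<notin> S" for u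
  proof -
    obtain e where e: "e \<in> X" "e < u" "\<And>v. e < v \<Longrightarrow> v \<le> u \<Longrightarrow> v \<in> gaps" using gaps_pred[OF u(1)] by blast
    have "u \<le> e + m"
    proof (rule ccontr)
      assume "\<not> ?thesis"
      then have long: "\<And>v. e < v \<Longrightarrow> v \<le> e + m \<Longrightarrow> v \<in> gaps" using e(3) by auto
      have "1 \<in> Y" using a2 assms m4 by (intro YI) auto
      show False
      \<comment> \<open>Three positive elements of \<open>Y\<close> that avoid the hole: 1, 3, 4 if
        \<open>a = 2\<close>, otherwise 1, 2, \<open>m\<close>.\<close>
      proof (cases "a = 2")
        case True
        then show False using far_dots[OF e(1) \<open>1 \<in> Y\<close>, of 3 4] long assms m4 YI by auto
      next
        case False
        then have "2 \<in> Y" using assms m4 by (intro YI) auto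
        then show False using far_dots[OF e(1) \<open>1 \<in> Y\<close>, of 2 m] Ym long m4 by auto
      qed
    qed
    moreover have "u - e \<notin> Y" using u(2) e(1) in_SI by blast
    ultimately have "u - e = a" using YI[of "u - e"] e(2) assms by fastforce
    then have "u = e + a" by simp
    then show ?thesis using e by blast
  qed
  obtain u where u: "u \<in> gaps" "u \<notin> S" using gaps_not_sub_S by auto
  obtain e where e: "e \<in> X" "u = e + a" "\<And>v. e < v \<Longrightarrow> v \<le> u \<Longrightarrow> v \<in> gaps" using hole[OF u] by blast
  have dot: "e + i \<in> S" if "0 < i" "i < a" for i using that e ab assms by (intro in_SI[of e] YI) auto
  show False
  proof (cases "u < c")
    case True
    have d1: "e + i \<in> left_new c" if "0 < i" "i < a" for i using that dot e True by (intro left_newI) auto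
    have "a = 2"
    proof (rule ccontr)
      assume "a \<noteq> 2"
      then have "e + 1 \<in> left_new c" "e + 2 \<in> left_new c" using d1 a2 by auto
      then show False using card_le_1I[OF fin_left_new, of c "e+1" "e+2"] D by auto
    qed
    then have mb: "2 \<le> m - b" and b2: "b = 2" using m4 assms by auto
    have e1: "e + 1 \<in> left_new c" using d1 \<open>a = 2\<close> by auto
    then have "card (left_new c) \<noteq> 0" using fin_left_new by auto
    then have "card (right_new (c + 1)) = 0" and "card (left_new c) \<le> 1" using D by linarith+
    then have "right_new (c + 1) = {}" using fin_right_new by simp
    have left: "v < c" if "v \<in> gaps" for v
      using right_empty[OF \<open>right_new (c+1) = {}\<close> c(2) mb that] that c by (cases v c rule: linorder_cases) (auto simp: gaps_iff, smt (verit))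
    have "gaps \<subseteq> {e + 1, e + 2}"
    proof
      fix v assume v: "v \<in> gaps"
      show "v \<in> {e + 1, e + 2}"
      proof (cases "v \<in> S")
        case True
        then show ?thesis using card_le_1I[OF fin_left_new \<open>card (left_new c) \<le> 1\<close> e1 left_newI[OF v left[OF v]]] by simp
      next
        case False
        obtain e' where e': "e' \<in> X" "v = e' + a" "\<And>w. e' < w \<Longrightarrow> w \<le> v \<Longrightarrow> w \<in> gaps" using hole[OF v False] by blast
        have "e' + 1 \<in> S" using e'(1) a2 m4 assms by (intro in_SI[of e'] YI) auto
        moreover have "e' + 1 \<in> gaps" using e' a2 by auto
        ultimately have "e' + 1 \<in> left_new c" using left by (intro left_newI) auto
        then show ?thesis using card_le_1I[OF fin_left_new \<open>card (left_new c) \<le> 1\<close> e1] e'(2) \<open>a = 2\<close> by force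
      qed
    qed
    then have "card gaps \<le> card {e + 1, e + 2}" by (intro card_mono) auto
    then show False using card_gaps_ge by simp
  next
    case False
    then have uc: "c + 1 < u" using u(1) c by (smt (verit) gaps_iff)
    then have ec: "c + 1 \<le> e" using e(3)[of "c+1"] c(2) by (force simp: gaps_iff)
    obtain f where f: "f \<in> X" "u < f" "\<And>v. u \<le> v \<Longrightarrow> v < f \<Longrightarrow> v \<in> gaps" using gaps_succ[OF u(1)] by blast
    have gap: "v \<in> gaps" if "e < v" "v < f" for v using that e(3) f(3) by (cases "v \<le> u") auto
    have d2: "f - i \<in> right_new (c + 1)" if "0 < i" "i \<le> m" "i \<noteq> m - a" "e < f - i" for i
    proof (rule right_newI)
      show "f - i + m \<in> S" using that f(1) assms by (intro in_SI[of f] YI) auto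
    qed (use that gap ec in auto)
    have D2': "card (right_new (c + 1)) \<le> 1" using D by simp
    have short: "f \<le> e + 3"
    proof (rule ccontr)
      assume "\<not> ?thesis"
      then have l: "e < f - 3" "e < f - 2" "e < f - 1" by auto
      \<comment> \<open>Among \<open>f - 1\<close>, \<open>f - 2\<close>, \<open>f - 3\<close> only
        \<open>f - (m - a)\<close> can fail to be new, so at least two new elements remain.\<close>
      consider "m - a = 1" | "m - a = 2" | "m - a \<noteq> 1" "m - a \<noteq> 2" by auto
      then show False
      proof cases
        case 1 then show False using card_le_1I[OF fin_right_new D2' d2[of 2] d2[of 3]] l m4 by auto
      next
        case 2 then show False using card_le_1I[OF fin_right_new D2' d2[of 1] d2[of 3]] l m4 by auto
      next
        case 3 then show False using card_le_1I[OF fin_right_new D2' d2[of 1] d2[of 2]] l m4 by auto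
      qed
    qed
    then have a: "a = 2" and fe: "f = e + 3" using f(2) e(2) a2 by auto
    then have mb: "m - a \<noteq> 1" using m4 by auto
    have f1: "f - 1 \<in> right_new (c + 1)" using d2[of 1] fe m4 mb by auto
    then have "card (right_new (c + 1)) \<noteq> 0" using fin_right_new by auto
    then have "card (left_new c) = 0" using D by linarith
    then have D1e: "left_new c = {}" using fin_left_new by simp
    have "gaps \<subseteq> {e + 1, e + 2}"
    proof
      fix v assume v: "v \<in> gaps"
      have "c < v"
      proof (rule ccontr)
        assume "\<not> ?thesis"
        then have vc: "v < c" using v c by (cases "v = c") (auto simp: gaps_iff)
        obtain e' where e': "e' \<in> X" "e' < v" "\<And>w. e' < w \<Longrightarrow> w \<le> v \<Longrightarrow> w \<in> gaps" using gaps_pred[OF v] by blast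
        have "e' + 1 \<in> S" using e'(1) a2 m4 assms by (intro in_SI[of e'] YI) auto
        then have "e' + 1 \<in> left_new c" using e' vc by (intro left_newI) auto
        then show False using D1e by auto
      qed
      then have cv: "c + 1 < v" using v c by (smt (verit) gaps_iff)
      obtain f' where f': "f' \<in> X" "v < f'" "\<And>w. v \<le> w \<Longrightarrow> w < f' \<Longrightarrow> w \<in> gaps" using gaps_succ[OF v] by blast
      have "f' - 1 + m \<in> S" using f'(1) mb m4 a assms by (intro in_SI[of f'] YI) auto
      then have "f' - 1 \<in> right_new (c + 1)" using f' cv by (intro right_newI) auto
      then have "f' - 1 = f - 1" using card_le_1I[OF fin_right_new D2' f1] by metis
      then have "f' = f" by simp
      then have "e < v" using f'(3)[of e] e(1) f' \<open>f' = f\<close> fe by (force simp: gaps_iff)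
      then show "v \<in> {e + 1, e + 2}" using f'(2) \<open>f' = f\<close> fe by auto
    qed
    then have "card gaps \<le> card {e + 1, e + 2}" by (intro card_mono) auto
    then show False using card_gaps_ge by simp
  qed
qed

text \<open>Three consecutive elements of \<open>X\<close> leave no new sums, and then every gap is
  a sum; so they do not occur. Hence a pair \<open>x\<close>, \<open>x + 1\<close> makes
  \<open>x + 2\<close> new from the left for every later pair. For the last pair this uses up the
  single new sum allowed and forces adjacent holes.\<close>

lemma two_holes:
  assumes "a < b" "2 \<le> a"
  shows False
proof -
  have m5: "5 \<le> m" using m_ge assms by auto
  have left_dot: "\<exists>e\<in>X. e < u \<and> e + 1 \<in> gaps \<inter> S" if u: "u \<in> gaps" for u
  proof -
    obtain e where e: "e \<in> X" "e < u" "\<And>v. e < v \<Longrightarrow> v \<le> u \<Longrightarrow> v \<in> gaps" using gaps_pred[OF u] by blast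
    have "e + 1 \<in> S" using e(1) assms m5 by (intro in_SI[of e] YI) auto
    then show ?thesis using e by auto
  qed
  have no3: "c + 2 \<notin> X" if c: "c \<in> paired" for c
  proof
    assume c2: "c + 2 \<in> X"
    have "left_new c = {}" "right_new (c + 2) = {}" using new_triple[of c] c c2 assms by (auto simp: paired_def)
    have cX: "c \<in> X" "c + 1 \<in> X" using c by (auto simp: paired_def)
    have right: "c + 2 < u" if u: "u \<in> gaps" for u
    proof -
      have "\<not> u < c" using left_dot[OF u] left_newI[of _ c] \<open>left_new c = {}\<close> by force
      moreover have "u \<noteq> c" "u \<noteq> c + 1" "u \<noteq> c + 2" using u cX c2 by (auto simp: gaps_iff)
      ultimately show ?thesis by simp
    qed
    have "gaps \<subseteq> S"
    proof
      fix u assume u: "u \<in> gaps"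
      have "m - b = 1" using right_empty[OF \<open>right_new (c+2) = {}\<close> c2 _ u right[OF u]] ab by force
      then show "u \<in> S" using right_filled[OF \<open>right_new (c+2) = {}\<close> c2 _ assms u right[OF u]] by simp
    qed
    then show False using gaps_not_sub_S by blast
  qed
  have later: "x + 2 \<in> left_new y" if xy: "x \<in> paired" "y \<in> paired" "x < y" for x y
  proof -
    have x: "x + 1 \<in> X" "x + 1 \<notin> paired" and y: "y \<in> X" "y + 1 \<in> X"
      using no3[OF xy(1)] xy by (auto simp: paired_def add.assoc)
    have "y \<noteq> x + 1" using x xy by auto
    then have "x + 1 < y" using xy by auto
    then show ?thesis
      using gap_after_unpaired[OF x _ y(1) assms(2)] by (auto simp: add.assoc intro: left_newI)
  qed
  define c where "c = Max paired"
  have paired_ne: "paired \<noteq> {}" using card_paired_ge[OF assms(2)] by auto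
  have c: "c \<in> paired" and c_max: "x \<in> paired \<Longrightarrow> x \<le> c" for x
    using fin_paired paired_ne by (auto simp: c_def)
  have cX: "c \<in> X" "c + 1 \<in> X" using c by (auto simp: paired_def)
  have "\<not> paired \<subseteq> {c}"
    using card_paired_ge[OF assms(2)] card_mono[of "{c}" paired] by auto
  then obtain c' where c': "c' \<in> paired" "c' < c" using c_max by (metis insertI1 less_le subsetI singletonD)
  have "left_new c \<noteq> {}" using later[OF c'(1) c c'(2)] by auto
  then have d: "b = a + 1" using new_pair_empty[OF cX] assms(1) by force
  have "card (left_new c) \<noteq> 0" using \<open>left_new c \<noteq> {}\<close> fin_left_new by auto
  then have "card (right_new (c + 1)) = 0" and D1c: "card (left_new c) \<le> 1" using new_pair_le[OF cX] by linarith+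
  then have D2c: "right_new (c + 1) = {}" using fin_right_new by simp
  have gaps_cases: "u < c \<or> c + 1 < u" if "u \<in> gaps" for u
    using that cX by (cases "u = c"; cases "u = c + 1") (auto simp: gaps_iff)
  show False
  \<comment> \<open>If \<open>m - b \<ge> 2\<close>, no gap follows the last pair, so at most one
    gap is a sum and there are at least three pairs; two earlier pairs then give two new sums.
    Otherwise every gap turns out to be a sum.\<close>
  proof (cases "2 \<le> m - b")
    case True
    have "gaps \<inter> S \<subseteq> left_new c"
      using gaps_cases right_empty[OF D2c cX(2) True] by (auto intro!: left_newI)
    then have "card (gaps \<inter> S) \<le> card (left_new c)" by (rule card_mono[OF fin_left_new])
    then have "3 \<le> card paired" using card_paired[OF assms(2)] D1c X5 by linarith
    then have "\<not> paired \<subseteq> {c, c'}"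
      using card_mono[of "{c, c'}" paired] c'(2) by auto
    then obtain x where "x \<in> paired" "x < c" "x \<noteq> c'" using c_max by (metis insertI1 insertI2 less_le subsetI)
    then have "x + 2 = c' + 2"
      using card_le_1I[OF fin_left_new D1c later later[OF c'(1) c c'(2)]] c by auto
    then show False using \<open>x \<noteq> c'\<close> by simp
  next
    case False
    then have mb: "m - b = 1" using ab by simp
    have "gaps \<subseteq> S"
    proof
      fix u assume u: "u \<in> gaps"
      show "u \<in> S"
      proof (cases "u < c")
        case True
        obtain e where e: "e \<in> X" "e < u" "\<And>v. e < v \<Longrightarrow> v \<le> u \<Longrightarrow> v \<in> gaps" using gaps_pred[OF u] by blast
        \<comment> \<open>Here \<open>a = m - 2 \<ge> 3\<close>, so both 1 and 2 lie in
          \<open>Y\<close>.\<close>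
        have eS: "e + 1 \<in> S" "e + 2 \<in> S" using e(1) d mb m5 by (auto intro!: in_SI[of e] YI)
        have "u = e + 1"
        proof (rule ccontr)
          assume "u \<noteq> e + 1"
          then have "e + 1 \<in> left_new c" "e + 2 \<in> left_new c" using e eS True by (auto intro!: left_newI)
          then show False using card_le_1I[OF fin_left_new D1c, of "e+1" "e+2"] by auto
        qed
        then show ?thesis using eS by simp
      next
        case False
        then show ?thesis using right_filled[OF D2c cX(2) mb assms u] gaps_cases[OF u] by auto
      qed
    qed
    then show False using gaps_not_sub_S by blast
  qed
qed

text \<open>The orientation forces \<open>b = m - 1\<close>. If \<open>X\<close> has a pair, no new
  sums are allowed, which confines the gaps to \<open>lo + 1\<close> and \<open>hi - 1\<close>. If
  it has none, \<open>X\<close> is so sparse that three new elements appear to the right of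
  \<open>lo\<close>.\<close>

lemma outer_holes:
  assumes "a = 1" "a < b"
  shows False
proof -
  have mb: "m - b = 1" and m5: "5 \<le> m" using m_ge assms ab ref by auto
  have Y: "2 \<in> Y" "3 \<in> Y" "m - 2 \<in> Y" "m - 3 \<in> Y" using mb m5 assms by (auto intro!: YI)
  show False
  proof (cases "paired = {}")
    case False
    then obtain c where c: "c \<in> X" "c + 1 \<in> X" by (auto simp: paired_def)
    have D: "left_new c = {}" "right_new (c + 1) = {}" using new_pair_empty[OF c] mb m5 assms by auto
    have left: "u = lo + 1" if u: "u \<in> gaps" "u < c" for u
    proof -
      have near: "v - 1 \<in> X \<and> v - 2 \<notin> X \<and> v - 3 \<notin> X" if v: "v \<in> gaps" "v < c" for v
      proof -
        obtain e where e: "e \<in> X" "e < v" "\<And>w. e < w \<Longrightarrow> w \<le> v \<Longrightarrow> w \<in> gaps" using gaps_pred[OF v(1)] by blast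
        have "e + 2 \<in> S" using e(1) Y by (intro in_SI[of e]) auto
        then have "\<not> e + 2 \<le> v" using left_newI[of "e+2" c] D e(3)[of "e+2"] v by auto
        then have "e = v - 1" using e(2) by simp
        moreover have "v \<notin> S" using D left_newI[of v c] v by auto
        then have "v - 2 \<notin> X" "v - 3 \<notin> X" using in_SI[of "v-2" v] in_SI[of "v-3" v] Y by auto
        ultimately show ?thesis using e by auto
      qed
      have n: "u - 1 \<in> X" "u - 2 \<notin> X" "u - 3 \<notin> X" using near[OF u] by auto
      \<comment> \<open>By \<open>near\<close>, a gap at \<open>u - 2\<close> would need
        \<open>u - 3 \<in> X\<close>, which the gap \<open>u\<close> forbids.\<close>
      have "\<not> lo < u - 2"
      proof
        assume "lo < u - 2"
        then have "u - 2 \<in> gaps" using n u by (auto simp: gaps_iff)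
        then show False using near[of "u-2"] n u by auto
      qed
      moreover have "u - 2 \<noteq> lo" using n lo by auto
      moreover have "lo \<le> u - 1" using lo_le[OF n(1)] .
      ultimately show ?thesis by simp
    qed
    have right: "u = hi - 1" if u: "u \<in> gaps" "c + 1 < u" for u
    proof -
      have near: "v + 1 \<in> X \<and> v + 2 \<notin> X \<and> v + 3 \<notin> X" if v: "v \<in> gaps" "c + 1 < v" for v
      proof -
        obtain e where e: "e \<in> X" "v < e" "\<And>w. v \<le> w \<Longrightarrow> w < e \<Longrightarrow> w \<in> gaps" using gaps_succ[OF v(1)] by blast
        have "e - 2 + m \<in> S" using e(1) Y by (intro in_SI[of e]) (auto simp: algebra_simps)
        then have "\<not> v \<le> e - 2" using right_newI[of "e-2" "c+1"] D e(3)[of "e-2"] v by auto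
        then have "e = v + 1" using e(2) by simp
        moreover have "v + m \<notin> S" using D right_newI[of v "c+1"] v by auto
        then have "v + 2 \<notin> X" "v + 3 \<notin> X" using in_SI[of "v+2" "v+m"] in_SI[of "v+3" "v+m"] Y by (auto simp: algebra_simps)
        ultimately show ?thesis using e by auto
      qed
      have n: "u + 1 \<in> X" "u + 2 \<notin> X" "u + 3 \<notin> X" using near[OF u] by auto
      have "\<not> u + 2 < hi"
      proof
        assume "u + 2 < hi"
        then have "u + 2 \<in> gaps" using n u by (auto simp: gaps_iff)
        then show False using near[of "u+2"] n u by (auto simp: add.assoc)
      qed
      moreover have "u + 2 \<noteq> hi" using n hi by auto
      moreover have "u + 1 \<le> hi" using hi_ge[OF n(1)] .
      ultimately show ?thesis by simp
    qed
    have "gaps \<subseteq> {lo + 1, hi - 1}"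
    proof
      fix u assume u: "u \<in> gaps"
      have "u \<noteq> c" "u \<noteq> c + 1" using u c by (auto simp: gaps_iff)
      then have "u < c \<or> c + 1 < u" by auto
      then show "u \<in> {lo + 1, hi - 1}" using left[OF u] right[OF u] by auto
    qed
    then have "card gaps \<le> card {lo + 1, hi - 1}" by (intro card_mono) auto
    also have "\<dots> \<le> 2" by (simp add: card_insert_if)
    finally show False using card_gaps_ge by simp
  next
    case True
    then have sparse: "x + 1 \<notin> X" if "x \<in> X" for x using that by (auto simp: paired_def)
    define X' where "X' = X - {lo}"
    have X': "finite X'" "4 \<le> card X'" using fin X5 lo by (auto simp: X'_def card_Diff_singleton)
    then have X'ne: "X' \<noteq> {}" by auto
    define sec where "sec = Min X'"
    have sec: "sec \<in> X'" "x \<in> X' \<Longrightarrow> sec \<le> x" for x using X' X'ne by (auto simp: sec_def)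
    have "lo < sec" using sec(1) lo_le[of sec] by (auto simp: X'_def less_le)
    moreover have "sec \<noteq> lo + 1" using sparse[OF lo] sec(1) by (auto simp: X'_def)
    ultimately have lo_sec: "lo + 2 \<le> sec" by simp
    \<comment> \<open>Since \<open>m - 2\<close> and \<open>m - 3\<close> lie in \<open>Y\<close>,
      both \<open>f - 2\<close> and \<open>f - 3\<close> are new unless they lie in
      \<open>X\<close>, and without pairs not both do. Leaving out the two smallest elements ensures
      \<open>f - 3 > lo\<close>.\<close>
    let ?t = "\<lambda>f. if f - 2 \<in> X then f - 3 else f - 2"
    have c3: "3 \<le> card (X' - {sec})" using X' sec by (simp add: card_Diff_singleton)
    have f1: "f - 1 \<notin> X" if "f \<in> X" for f using sparse[of "f-1"] that by auto
    have "inj_on ?t (X' - {sec})"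
    proof (rule inj_onI)
      fix f g assume "f \<in> X' - {sec}" "g \<in> X' - {sec}" and eq: "?t f = ?t g"
      then have fg: "f \<in> X" "g \<in> X" by (auto simp: X'_def)
      show "f = g" using eq f1[OF fg(1)] f1[OF fg(2)] fg by (auto split: if_splits)
    qed
    moreover have "?t ` (X' - {sec}) \<subseteq> right_new lo"
    proof
      fix t assume "t \<in> ?t ` (X' - {sec})"
      then obtain f where f: "f \<in> X' - {sec}" "t = ?t f" by blast
      have fX: "f \<in> X" using f by (simp add: X'_def)
      have "sec < f" using sec(2)[of f] f by (auto simp: less_le)
      moreover have "f \<noteq> sec + 1" using sparse[of sec] fX sec(1) by (auto simp: X'_def)
      ultimately have fs: "sec + 2 \<le> f" by simp
      show "t \<in> right_new lo"
      proof (cases "f - 2 \<in> X")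
        case True
        then have "f - 3 \<notin> X" using f1[of "f-2"] by simp
        moreover have "f - 3 + m \<in> S" using fX Y by (intro in_SI[of f]) (auto simp: algebra_simps)
        ultimately show ?thesis using f(2) True fs lo_sec by (auto simp: right_new_def)
      next
        case False
        moreover have "f - 2 + m \<in> S" using fX Y by (intro in_SI[of f]) (auto simp: algebra_simps)
        ultimately show ?thesis using f(2) fs lo_sec by (auto simp: right_new_def)
      qed
    qed
    ultimately have "card (X' - {sec}) \<le> card (right_new lo)" using card_inj_on_le fin_right_new by blast
    then show False using new_point[OF lo] c3 by simp
  qed
qed

lemma no_wide_holes: False
  using single_hole two_holes outer_holes ab by fastforce

end

section \<open>Periodic sets of integers\<close>

text \<open>Sets of residues are lifted to their preimages in the integers, where order and windows
  make sense; \<open>cnt\<close> recovers the size of the set of residues.\<close>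

definition periodic :: "int \<Rightarrow> int set \<Rightarrow> bool" where
  "periodic n P \<longleftrightarrow> (\<forall>x. x + n \<in> P \<longleftrightarrow> x \<in> P)"

definition cnt :: "int \<Rightarrow> int set \<Rightarrow> int" where
  "cnt n P = int (card (P \<inter> {0..<n}))"

lemma periodicI: "(\<And>x. x + n \<in> P \<longleftrightarrow> x \<in> P) \<Longrightarrow> periodic n P"
  by (simp add: periodic_def)

lemma periodicD: "periodic n P \<Longrightarrow> x + n \<in> P \<longleftrightarrow> x \<in> P"
  by (simp add: periodic_def)

lemma periodic_mult:
  assumes "periodic n P"
  shows "x + n * k \<in> P \<longleftrightarrow> x \<in> P"
proof (induction k arbitrary: x rule: int_induct[where k = 0])
  case (step1 i)
  have eq: "x + n * (i + 1) = (x + n * i) + n" by (simp add: algebra_simps)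
  show ?case unfolding eq using step1 periodicD[OF assms, of "x + n * i"] by blast
next
  case (step2 i)
  have eq: "x + n * (i - 1) + n = x + n * i" by (simp add: algebra_simps)
  show ?case using step2 periodicD[OF assms, of "x + n * (i - 1)", unfolded eq] by blast
qed simp

lemma periodic_mod:
  assumes "periodic n P"
  shows "x mod n \<in> P \<longleftrightarrow> x \<in> P"
  using periodic_mult[OF assms, of "x mod n" "x div n"] by simp

lemma cnt_mono: "P \<subseteq> Q \<Longrightarrow> cnt n P \<le> cnt n Q"
  by (auto simp: cnt_def intro!: card_mono)

lemma cnt_Un_le: "cnt n (P \<union> Q) \<le> cnt n P + cnt n Q"
proof -
  have "card ((P \<inter> {0..<n}) \<union> (Q \<inter> {0..<n})) \<le> card (P \<inter> {0..<n}) + card (Q \<inter> {0..<n})"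
    by (rule card_Un_le)
  then show ?thesis by (simp add: cnt_def Int_Un_distrib2)
qed

lemma cnt_Un:
  assumes "P \<inter> Q = {}"
  shows "cnt n (P \<union> Q) = cnt n P + cnt n Q"
proof -
  have "card ((P \<inter> {0..<n}) \<union> (Q \<inter> {0..<n})) = card (P \<inter> {0..<n}) + card (Q \<inter> {0..<n})"
    by (rule card_Un_disjoint) (use assms in auto)
  then show ?thesis by (simp add: cnt_def Int_Un_distrib2)
qed

lemma cnt_Compl:
  assumes "0 < n"
  shows "cnt n (- P) = n - cnt n P"
proof -
  have "cnt n (P \<union> - P) = cnt n P + cnt n (- P)" by (rule cnt_Un) auto
  moreover have "cnt n (P \<union> - P) = n" using assms by (simp add: cnt_def)
  ultimately show ?thesis by simp
qed

lemma cnt_window: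
  assumes n: "0 < n" and P: "periodic n P"
  shows "int (card (P \<inter> {k..<k + n})) = cnt n P"
proof -
  have "bij_betw (\<lambda>x. x mod n) (P \<inter> {k..<k + n}) (P \<inter> {0..<n})"
    unfolding bij_betw_def
  proof
    show "inj_on (\<lambda>x. x mod n) (P \<inter> {k..<k + n})"
    proof (rule inj_onI)
      fix x y assume xy: "x \<in> P \<inter> {k..<k + n}" "y \<in> P \<inter> {k..<k + n}" "x mod n = y mod n"
      have "(x - k) mod n = (y - k) mod n" using xy(3) by (metis mod_diff_left_eq)
      moreover have "(x - k) mod n = x - k" "(y - k) mod n = y - k" using xy by auto
      ultimately show "x = y" by simp
    qed
    show "(\<lambda>x. x mod n) ` (P \<inter> {k..<k + n}) = P \<inter> {0..<n}"
    proof (intro equalityI subsetI)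
      fix y assume "y \<in> (\<lambda>x. x mod n) ` (P \<inter> {k..<k + n})"
      then show "y \<in> P \<inter> {0..<n}" using n periodic_mod[OF P] by auto
    next
      fix y assume y: "y \<in> P \<inter> {0..<n}"
      let ?x = "k + (y - k) mod n"
      have "?x mod n = y" using y by (simp add: mod_add_right_eq)
      moreover have "?x \<in> P" using periodic_mod[OF P, of ?x] y \<open>?x mod n = y\<close> by simp
      moreover have "?x \<in> {k..<k + n}" using n by simp
      ultimately show "y \<in> (\<lambda>x. x mod n) ` (P \<inter> {k..<k + n})" by (metis IntI image_eqI)
    qed
  qed
  then show ?thesis by (simp add: cnt_def bij_betw_same_card)
qed

lemma periodic_Un: "periodic n P \<Longrightarrow> periodic n Q \<Longrightarrow> periodic n (P \<union> Q)"
  by (simp add: periodic_def)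

lemma periodic_shift: "periodic n P \<Longrightarrow> periodic n {x. x + j \<in> P}"
  unfolding periodic_def by (metis add.assoc add.commute mem_Collect_eq)

lemma cnt_shift:
  assumes "0 < n" "periodic n P"
  shows "cnt n {x. x + j \<in> P} = cnt n P"
proof -
  have "card ((\<lambda>x. x + j) ` ({x. x + j \<in> P} \<inter> {0..<n})) = card ({x. x + j \<in> P} \<inter> {0..<n})"
    by (rule card_image) auto
  moreover have "(\<lambda>x. x + j) ` ({x. x + j \<in> P} \<inter> {0..<n}) = P \<inter> {j..<j + n}"
    by (auto simp: image_iff intro!: bexI[of _ "_ - j"])
  ultimately show ?thesis using cnt_window[OF assms, of j] by (simp add: cnt_def)
qed

lemma cnt_reflect:
  assumes "0 < n" "periodic n P"
  shows "cnt n {x. j - x \<in> P} = cnt n P"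
proof -
  have "card ((\<lambda>x. j - x) ` ({x. j - x \<in> P} \<inter> {0..<n})) = card ({x. j - x \<in> P} \<inter> {0..<n})"
    by (rule card_image) (auto simp: inj_on_def)
  moreover have "(\<lambda>x. j - x) ` ({x. j - x \<in> P} \<inter> {0..<n}) = P \<inter> {j - n + 1..<j - n + 1 + n}"
    by (auto simp: image_iff intro!: bexI[of _ "j - _"])
  ultimately show ?thesis using cnt_window[OF assms, of "j - n + 1"] by (simp add: cnt_def)
qed

lemma periodic_reflect: "periodic n P \<Longrightarrow> periodic n {x. j - x \<in> P}"
  using periodicD[of n P] by (intro periodicI) (metis add_diff_cancel_right' diff_add_eq diff_diff_eq2 mem_Collect_eq)

text \<open>Counted up to the period are the solutions of \<open>p = q + j\<close> with
  \<open>p \<in> P\<close>, \<open>q \<in> Q\<close>, \<open>j \<in> J\<close>: each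
  \<open>p\<close> has at least \<open>k\<close>, each \<open>q\<close> at most \<open>c\<close>.
  Translation by \<open>j\<close> passes from one count to the other.\<close>

lemma cnt_double_count:
  fixes J :: "int set"
  assumes n: "0 < n" and P: "periodic n P" and Q: "periodic n Q" and J: "finite J"
    and k: "\<And>p. p \<in> P \<Longrightarrow> k \<le> int (card {j \<in> J. p - j \<in> Q})"
    and c: "\<And>q. q \<in> Q \<Longrightarrow> int (card {j \<in> J. q + j \<in> P}) \<le> c"
  shows "k * cnt n P \<le> c * cnt n Q"
proof -
  let ?I = "{0..<n}"
  have count: "int (card {j \<in> J. R j}) = (\<Sum>j\<in>J. if R j then 1 else 0)" for R
    using J by (simp add: sum.If_cases Int_def)
  have swap: "(\<Sum>p\<in>A \<inter> ?I. int (card {j \<in> J. R p j})) = (\<Sum>j\<in>J. cnt n {p \<in> A. R p j})" for A R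
  proof -
    have "(\<Sum>p\<in>A \<inter> ?I. int (card {j \<in> J. R p j})) = (\<Sum>p\<in>A \<inter> ?I. \<Sum>j\<in>J. if R p j then 1 else 0)"
      by (simp add: count)
    also have "\<dots> = (\<Sum>j\<in>J. \<Sum>p\<in>A \<inter> ?I. if R p j then 1 else 0)" by (rule sum.swap)
    also have "\<dots> = (\<Sum>j\<in>J. cnt n {p \<in> A. R p j})"
      by (intro sum.cong refl) (simp add: sum.If_cases cnt_def, rule arg_cong[of _ _ card], auto)
    finally show ?thesis .
  qed
  have "k * cnt n P = (\<Sum>p\<in>P \<inter> ?I. k)" by (simp add: cnt_def)
  also have "\<dots> \<le> (\<Sum>p\<in>P \<inter> ?I. int (card {j \<in> J. p - j \<in> Q}))" using k by (intro sum_mono) auto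
  also have "\<dots> = (\<Sum>j\<in>J. cnt n {p \<in> P. p - j \<in> Q})" by (rule swap)
  also have "\<dots> = (\<Sum>j\<in>J. cnt n {q \<in> Q. q + j \<in> P})"
  proof (intro sum.cong refl)
    fix j
    have per: "periodic n {p \<in> P. p - j \<in> Q}"
      using periodicD[OF P] periodicD[OF Q] by (intro periodicI) (metis (no_types, lifting) add_diff_eq diff_add_eq mem_Collect_eq)
    have "{x. x + j \<in> {p \<in> P. p - j \<in> Q}} = {q \<in> Q. q + j \<in> P}" by auto
    then show "cnt n {p \<in> P. p - j \<in> Q} = cnt n {q \<in> Q. q + j \<in> P}" using cnt_shift[OF n per, of j] by simp
  qed
  also have "\<dots> = (\<Sum>q\<in>Q \<inter> ?I. int (card {j \<in> J. q + j \<in> P}))" by (rule swap[symmetric])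
  also have "\<dots> \<le> (\<Sum>q\<in>Q \<inter> ?I. c)" using c by (intro sum_mono) auto
  also have "\<dots> = c * cnt n Q" by (simp add: cnt_def)
  finally show ?thesis .
qed

lemma ex_less3:
  fixes A :: "int set"
  assumes "3 \<le> card A"
  obtains x y z where "x \<in> A" "y \<in> A" "z \<in> A" "x < y" "y < z"
proof -
  let ?l = "sorted_list_of_set A"
  have f: "finite A" using assms by (metis card.infinite not_numeral_le_zero)
  have l: "length ?l = card A" "set ?l = A" using f by auto
  have s: "?l ! i < ?l ! j" if "i < j" "j < card A" for i j
    using sorted_wrt_nth_less[OF strict_sorted_list_of_set[of A] that(1)] that(2) l(1) by simp
  have i: "?l ! i \<in> A" if "i < card A" for i using that l nth_mem by metis
  show thesis using that[of "?l ! 0" "?l ! 1" "?l ! 2"] s[of 0 1] s[of 1 2] i[of 0] i[of 1] i[of 2] assms by auto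
qed

lemma ex_less5:
  fixes A :: "int set"
  assumes "5 \<le> card A"
  obtains x y z u v where "x \<in> A" "y \<in> A" "z \<in> A" "u \<in> A" "v \<in> A" "x < y" "y < z" "z < u" "u < v"
proof -
  let ?l = "sorted_list_of_set A"
  have f: "finite A" using assms by (metis card.infinite not_numeral_le_zero)
  have l: "length ?l = card A" "set ?l = A" using f by auto
  have s: "?l ! i < ?l ! j" if "i < j" "j < card A" for i j
    using sorted_wrt_nth_less[OF strict_sorted_list_of_set[of A] that(1)] that(2) l(1) by simp
  have i: "?l ! i \<in> A" if "i < card A" for i using that l nth_mem by metis
  show thesis using that[of "?l ! 0" "?l ! 1" "?l ! 2" "?l ! 3" "?l ! 4"] s[of 0 1] s[of 1 2] s[of 2 3] s[of 3 4]
     i[of 0] i[of 1] i[of 2] i[of 3] i[of 4] assms by auto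
qed

section \<open>The case in which every window is hit\<close>

text \<open>\<open>XZ\<close> expresses that \<open>X + Y\<close> avoids \<open>Z\<close> for
  \<open>Y\<close> the interval \<open>{0..m}\<close> without its holes; \<open>nextZ\<close> and
  \<open>prevX\<close> say that every window is hit. The conditional in \<open>total\<close> is the
  number of holes, so at most \<open>card Y + 1\<close> residues lie in neither set.\<close>

locale spread =
  fixes n m a b :: int and X Z :: "int set"
  assumes n: "0 < n" and perX: "periodic n X" and perZ: "periodic n Z"
    and ab: "0 < a" "a \<le> b" "b < m" and ref: "m - b \<le> a"
    and XZ: "x \<in> X \<Longrightarrow> z \<in> Z \<Longrightarrow> x \<le> z \<Longrightarrow> z \<le> x + m \<Longrightarrow> z = x + a \<or> z = x + b"
    and nextZ: "x \<in> X \<Longrightarrow> \<exists>z\<in>Z. x \<le> z \<and> z \<le> x + m"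
    and prevX: "z \<in> Z \<Longrightarrow> \<exists>x\<in>X. x \<le> z \<and> z \<le> x + m"
    and total: "n \<le> cnt n X + cnt n Z + m + 2 - (if a = b then 1 else 2)"
    and m_ge: "a = b \<Longrightarrow> 4 \<le> m" "a \<noteq> b \<Longrightarrow> 5 \<le> m"
    and X5: "5 \<le> cnt n X" and Z5: "5 \<le> cnt n Z"
begin

abbreviation "h \<equiv> (if a = b then 1 else 2 :: int)"
text \<open>Every \<open>z \<in> heads\<close> starts a block of \<open>Z\<close>, and \<open>tails\<close> are the ends of the preceding blocks of \<open>X\<close>. A block of
  \<open>X\<close> or \<open>Z\<close> has at most two elements; if it has two, their distance is \<open>b - a\<close>, and \<open>twinX\<close>, \<open>twinZ\<close>
  contain the one which is farther from the other block.\<close>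
definition "free = - (X \<union> Z)"
definition "edge j = {z \<in> Z. z - j \<in> X \<and> (\<forall>t. z - j < t \<and> t < z \<longrightarrow> t \<in> free)}"
definition "heads = edge a \<union> edge b"
definition "tails = {x. x + a \<in> edge a} \<union> {x. x + b \<in> edge b}"
definition "twinX = {x \<in> X. x + (b - a) \<in> X \<and> x + b \<in> Z \<and> x + a \<notin> Z}"
definition "twinZ = {z \<in> Z. z - (b - a) \<in> Z \<and> z - b \<in> X \<and> z - a \<notin> X}"

section \<open>Block structure of \<open>X\<close> and \<open>Z\<close>\<close>

lemma free_iff: "t \<in> free \<longleftrightarrow> t \<notin> X \<and> t \<notin> Z" by (simp add: free_def)

lemma disj: "x \<in> X \<Longrightarrow> x \<notin> Z" using XZ[of x x] ab by auto

lemma per_free: "periodic n free"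
  using perX perZ by (simp add: periodic_def free_def)

lemma per_edge: "periodic n (edge j)"
proof (rule periodicI)
  fix z
  have X: "z + n - j \<in> X \<longleftrightarrow> z - j \<in> X" using periodicD[OF perX, of "z - j"] by (simp add: algebra_simps)
  have "(\<forall>t. z + n - j < t \<and> t < z + n \<longrightarrow> t \<in> free) \<longleftrightarrow> (\<forall>t. z - j < t \<and> t < z \<longrightarrow> t \<in> free)"
    (is "?L \<longleftrightarrow> ?R")
  proof
    assume L: ?L
    show ?R
    proof (intro allI impI)
      fix t assume "z - j < t \<and> t < z"
      then have "t + n \<in> free" using L by auto
      then show "t \<in> free" using periodicD[OF per_free] by simp
    qed
  next
    assume R: ?R
    show ?L
    proof (intro allI impI)
      fix t assume "z + n - j < t \<and> t < z + n"
      then have "t - n \<in> free" using R by auto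
      then show "t \<in> free" using periodicD[OF per_free, of "t - n"] by simp
    qed
  qed
  then show "z + n \<in> edge j \<longleftrightarrow> z \<in> edge j" using X periodicD[OF perZ] by (auto simp: edge_def)
qed

lemma per_heads: "periodic n heads" unfolding heads_def by (intro periodic_Un per_edge)

lemma per_tails: "periodic n tails" unfolding tails_def by (intro periodic_Un periodic_shift per_edge)

lemma edgeD: "z \<in> edge j \<Longrightarrow> z \<in> Z" "z \<in> edge j \<Longrightarrow> z - j \<in> X" "z \<in> edge j \<Longrightarrow> z - j < t \<Longrightarrow> t < z \<Longrightarrow> t \<notin> X \<and> t \<notin> Z"
  by (auto simp: edge_def free_iff)

lemma heads_elim:
  assumes "z \<in> heads"
  obtains e where "e \<in> X" "e = z - a \<or> e = z - b" "e < z" "z \<le> e + m" "\<forall>t. e < t \<and> t < z \<longrightarrow> t \<notin> X \<and> t \<notin> Z"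
proof -
  consider "z \<in> edge a" | "z \<in> edge b" using assms by (auto simp: heads_def)
  then show thesis
  proof cases
    case 1 then show thesis using that[of "z - a"] edgeD[of z a] ab by auto
  next
    case 2 then show thesis using that[of "z - b"] edgeD[of z b] ab by auto
  qed
qed

lemma heads_in_Z: "z \<in> heads \<Longrightarrow> z \<in> Z" by (auto simp: heads_def edge_def)

text \<open>For \<open>a < b\<close> no \<open>z\<close> is in both edge sets, as
  \<open>z - a \<in> X\<close> would lie between \<open>z - b\<close> and \<open>z\<close>. So the
  heads are counted exactly, while the tails are a union of shifts of the same two sets.\<close>

lemma cnt_tails: "cnt n tails \<le> cnt n heads"
proof (cases "a = b")
  case True
  then show ?thesis unfolding tails_def heads_def using cnt_shift[OF n per_edge, of a a] by simp
next
  case False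
  have "z \<notin> edge b" if "z \<in> edge a" for z
    using edgeD(2)[OF that] edgeD(3)[of z b "z - a"] ab False by auto
  then have "cnt n heads = cnt n (edge a) + cnt n (edge b)" unfolding heads_def by (intro cnt_Un) auto
  then show ?thesis
    using cnt_Un_le[of n "{x. x + a \<in> edge a}" "{x. x + b \<in> edge b}"]
      cnt_shift[OF n per_edge, of a a] cnt_shift[OF n per_edge, of b b] by (simp add: tails_def)
qed

text \<open>As \<open>a\<close> is the smallest hole, an element of either set in between would give
  an element of \<open>Z\<close> too close after one of \<open>X\<close>.\<close>

lemma edge_aI: "x \<in> X \<Longrightarrow> x + a \<in> Z \<Longrightarrow> x + a \<in> edge a"
proof -
  assume x: "x \<in> X" "x + a \<in> Z"
  have "t \<in> free" if "x < t" "t < x + a" for t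
  proof -
    have "t \<notin> Z" using XZ[OF x(1), of t] that ab by auto
    moreover have "t \<notin> X" using XZ[OF _ x(2), of t] that ab by auto
    ultimately show ?thesis by (simp add: free_iff)
  qed
  then show ?thesis using x by (auto simp: edge_def)
qed

text \<open>The element \<open>x\<close> sees \<open>x + a\<close> or \<open>x + b\<close> in
  \<open>Z\<close>. If only \<open>x + b\<close>, the one element that can separate the two is
  \<open>x + (b - a)\<close>, which sees \<open>x + b\<close> at distance \<open>a\<close> and makes
  \<open>x\<close> a twin.\<close>

lemma X_sub: "X \<subseteq> tails \<union> twinX"
proof
  fix x assume x: "x \<in> X"
  show "x \<in> tails \<union> twinX"
  proof (cases "x + a \<in> Z")
    case True
    then show ?thesis using edge_aI[OF x] by (auto simp: tails_def)
  next
    case a: False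
    then have xb: "x + b \<in> Z" using nextZ[OF x] XZ[OF x] by blast
    show ?thesis
    proof (cases "x + (b - a) \<in> X")
      case True
      then show ?thesis using x a xb by (auto simp: twinX_def)
    next
      case False
      have "t \<in> free" if "x < t" "t < x + b" for t
      proof -
        have "t \<notin> Z" using XZ[OF x, of t] that ab a by auto
        moreover have "t \<notin> X" using XZ[OF _ xb, of t] that ab False by (auto simp: algebra_simps)
        ultimately show ?thesis by (simp add: free_iff)
      qed
      then have "x + b \<in> edge b" using x xb by (auto simp: edge_def)
      then show ?thesis by (auto simp: tails_def)
    qed
  qed
qed

lemma Z_sub: "Z \<subseteq> heads \<union> twinZ"
proof
  fix z assume z: "z \<in> Z"
  show "z \<in> heads \<union> twinZ"
  proof (cases "z - a \<in> X")
    case True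
    then show ?thesis using edge_aI[of "z - a"] z by (auto simp: heads_def)
  next
    case a: False
    obtain x where x: "x \<in> X" "x \<le> z" "z \<le> x + m" using prevX[OF z] by blast
    then have "z = x + b" using XZ[OF x(1) z] a by auto
    then have xb: "z - b \<in> X" using x by simp
    show ?thesis
    proof (cases "z - (b - a) \<in> Z")
      case True
      then show ?thesis using z a xb by (auto simp: twinZ_def)
    next
      case False
      have "t \<in> free" if "z - b < t" "t < z" for t
      proof -
        have "t \<notin> Z"
        proof
          assume "t \<in> Z"
          then have "t = z - (b - a)" using XZ[OF xb, of t] that ab by auto
          then show False using False \<open>t \<in> Z\<close> by simp
        qed
        moreover have "t \<notin> X" using XZ[OF _ z, of t] that ab a by (auto simp: algebra_simps)
        ultimately show ?thesis by (simp add: free_iff)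
      qed
      then have "z \<in> edge b" using z xb by (auto simp: edge_def)
      then show ?thesis by (auto simp: heads_def)
    qed
  qed
qed

lemma per_twinX: "periodic n twinX"
proof (rule periodicI)
  fix x
  have "x + n + j = x + j + n" for j by simp
  then show "x + n \<in> twinX \<longleftrightarrow> x \<in> twinX"
    using periodicD[OF perX] periodicD[OF perZ] by (simp only: twinX_def mem_Collect_eq)
qed

lemma per_twinZ: "periodic n twinZ"
proof (rule periodicI)
  fix x
  have "x + n - j = x - j + n" for j by simp
  then show "x + n \<in> twinZ \<longleftrightarrow> x \<in> twinZ"
    using periodicD[OF perX] periodicD[OF perZ] by (simp only: twinZ_def mem_Collect_eq)
qed

lemma twin_empty: "a = b \<Longrightarrow> twinX = {}" "a = b \<Longrightarrow> twinZ = {}"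
  unfolding twinX_def twinZ_def by auto

text \<open>The partner \<open>x + (b - a)\<close> of a twin sees \<open>x + b\<close> at distance
  \<open>a\<close>, so it is a tail.\<close>

lemma cnt_twinX: "cnt n twinX \<le> cnt n heads"
proof -
  have "twinX \<subseteq> {x. x + (b - a) \<in> tails}"
    using edge_aI by (force simp: twinX_def tails_def add.assoc)
  then show ?thesis using cnt_mono cnt_shift[OF n per_tails, of "b - a"] cnt_tails by (metis order_trans)
qed

lemma cnt_twinZ: "cnt n twinZ \<le> cnt n heads"
proof -
  have "z - (b - a) \<in> heads" if "z \<in> twinZ" for z
    using that edge_aI[of "z - b"] by (auto simp: twinZ_def heads_def algebra_simps)
  then have "twinZ \<subseteq> {x. x + (a - b) \<in> heads}" by (auto simp: algebra_simps)
  then show ?thesis using cnt_mono cnt_shift[OF n per_heads, of "a - b"] by (metis)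
qed

lemma cntX: "cnt n X \<le> cnt n heads + cnt n twinX"
  using cnt_mono[OF X_sub, of n] cnt_Un_le[of n tails twinX] cnt_tails by linarith

lemma cntZ: "cnt n Z \<le> cnt n heads + cnt n twinZ"
  using cnt_mono[OF Z_sub, of n] cnt_Un_le[of n heads twinZ] by linarith

lemma cntXZ: "cnt n X \<le> h * cnt n heads" "cnt n Z \<le> h * cnt n heads"
  using cntX cntZ cnt_twinX cnt_twinZ twin_empty by (auto simp: cnt_def)

lemma cnt_free: "cnt n free \<le> m + 2 - h" and n_eq: "n = cnt n X + cnt n Z + cnt n free"
proof -
  have "cnt n (X \<union> Z) = cnt n X + cnt n Z" using disj by (intro cnt_Un) auto
  then show "n = cnt n X + cnt n Z + cnt n free" unfolding free_def using cnt_Compl[OF n, of "X \<union> Z"] by simp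
  then show "cnt n free \<le> m + 2 - h" using total by simp
qed

section \<open>Counting free elements in windows\<close>

lemma card_pair_le: "(a = b \<Longrightarrow> p = q) \<Longrightarrow> A \<subseteq> {p, q} \<Longrightarrow> int (card A) \<le> h"
  using card_mono[of "{p, q}" A] by (cases "a = b"; cases "p = q") auto

lemma marks_X:
  assumes "z \<in> Z"
  shows "int (card {j \<in> {1..m}. z - j \<in> X}) \<le> h"
proof -
  have "{j \<in> {1..m}. z - j \<in> X} \<subseteq> {a, b}"
  proof
    fix j assume "j \<in> {j \<in> {1..m}. z - j \<in> X}"
    then show "j \<in> {a, b}" using XZ[OF _ assms, of "z - j"] by auto
  qed
  then show ?thesis by (rule card_pair_le[rotated])
qed

lemma heads_before:
  assumes "z \<in> Z" "z' \<in> heads" "z < z'"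
  obtains e where "e \<in> X" "z < e" "e < z'" "e = z' - a \<or> e = z' - b"
proof -
  obtain e where e: "e \<in> X" "e = z' - a \<or> e = z' - b" "e < z'"
    and et: "\<forall>t. e < t \<and> t < z' \<longrightarrow> t \<notin> X \<and> t \<notin> Z"
    using heads_elim[OF assms(2)] by blast
  have "\<not> e < z" "e \<noteq> z" using et[THEN spec, of z] e(1) assms disj by auto
  then have "z < e" by simp
  then show thesis using that e by blast
qed

text \<open>The \<open>m\<close> positions before a head contain at most \<open>h\<close> elements
  of \<open>X\<close> and \<open>h\<close> of \<open>Z\<close>, hence at least
  \<open>m - 2 * h\<close> free ones, and each free element precedes at most \<open>c\<close> heads
  in this way.\<close>

lemma windows:
  assumes marks: "\<And>z. z \<in> heads \<Longrightarrow> int (card {j \<in> {1..m}. z - j \<in> Z}) \<le> h"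
    and c: "\<And>d. int (card {j \<in> {1..m}. d + j \<in> heads}) \<le> c"
  shows "(m - 2 * h) * cnt n heads \<le> c * cnt n free"
proof (rule cnt_double_count[OF n per_heads per_free, of "{1..m}"])
  fix z assume z: "z \<in> heads"
  let ?A = "\<lambda>P. {j \<in> {1..m}. z - j \<in> P}"
  have "{1..m} = ?A X \<union> ?A Z \<union> ?A free" by (auto simp: free_iff)
  then have "card {1..m} = card (?A X \<union> ?A Z \<union> ?A free)" by presburger
  then have "card {1..m} \<le> card (?A X) + card (?A Z) + card (?A free)"
    using card_Un_le[of "?A X \<union> ?A Z" "?A free"] card_Un_le[of "?A X" "?A Z"] by linarith
  then show "m - 2 * h \<le> int (card (?A free))"
    using marks[OF z] marks_X[OF heads_in_Z[OF z]] ab by simp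
qed (use c in auto)

lemma count_le_2:
  assumes no: "\<And>z1 z2 z3. z1 \<in> heads \<Longrightarrow> z2 \<in> heads \<Longrightarrow> z3 \<in> heads \<Longrightarrow> z1 < z2 \<Longrightarrow> z2 < z3 \<Longrightarrow> z3 < z1 + m \<Longrightarrow> False"
  shows "int (card {j \<in> {1..m}. d + j \<in> heads}) \<le> 2"
proof (rule ccontr)
  assume "\<not> ?thesis"
  then have "3 \<le> card {j \<in> {1..m}. d + j \<in> heads}" by linarith
  then obtain i j k where "i \<in> {j \<in> {1..m}. d + j \<in> heads}" "j \<in> {j \<in> {1..m}. d + j \<in> heads}" "k \<in> {j \<in> {1..m}. d + j \<in> heads}" "i < j" "j < k"
    by (rule ex_less3)
  then show False using no[of "d + i" "d + j" "d + k"] by auto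
qed

text \<open>Everything between the head \<open>z\<close> and the element \<open>e\<close> of
  \<open>X\<close> that it sees is free, so \<open>x < z' < e\<close>. Then \<open>x = z - b\<close>
  and \<open>e = z - a\<close>, but \<open>z'\<close> is at least \<open>a \<ge> b - a\<close> above
  \<open>x\<close> and so not below \<open>e\<close>.\<close>

lemma close_holes_order:
  assumes "b - a \<le> a" "z \<in> heads" "x \<in> X" "z' \<in> Z" "z - m \<le> x" "x < z'" "z' < z"
  shows False
proof -
  obtain e where e: "e \<in> X" "e = z - a \<or> e = z - b" "e < z"
    and et: "\<forall>t. e < t \<and> t < z \<longrightarrow> t \<notin> X \<and> t \<notin> Z"
    using heads_elim[OF assms(2)] by blast
  have "\<not> e < z'" "e \<noteq> z'" using et[THEN spec, of z'] e(1) assms disj by auto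
  then have "z' < e" by simp
  moreover have "x = z - a \<or> x = z - b" using XZ[OF assms(3) heads_in_Z[OF assms(2)]] assms by auto
  ultimately have "x = z - b" "e = z - a" using e(2) assms ab by auto
  moreover have "z' = x + a \<or> z' = x + b" using XZ[OF assms(3,4)] assms by auto
  ultimately show False using \<open>z' < e\<close> assms(1) ab by auto
qed

lemma offsets_le:
  assumes "\<And>w. w \<in> Z \<Longrightarrow> z - m \<le> w \<Longrightarrow> w < z \<Longrightarrow> w = p \<or> w = q" "a = b \<Longrightarrow> p = q"
  shows "int (card {j \<in> {1..m}. z - j \<in> Z}) \<le> h"
proof (rule card_pair_le)
  show "{j \<in> {1..m}. z - j \<in> Z} \<subseteq> {z - p, z - q}"
  proof
    fix j assume "j \<in> {j \<in> {1..m}. z - j \<in> Z}"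
    then have "z - j = p \<or> z - j = q" using assms(1)[of "z - j"] by simp
    then show "j \<in> {z - p, z - q}" by auto
  qed
qed (use assms(2) in simp)

text \<open>If no element of \<open>X\<close> precedes them in the window, the elements of \<open>Z\<close> in it all see the same element of \<open>X\<close>
  outside the window.\<close>
lemma same_source:
  assumes "finite W" "W \<noteq> {}" "W \<subseteq> Z" "\<And>x w. x \<in> X \<Longrightarrow> w \<in> W \<Longrightarrow> k \<le> x \<Longrightarrow> x < w \<Longrightarrow> False" "\<And>w. w \<in> W \<Longrightarrow> k \<le> w"
  obtains x where "x \<in> X" "x < k" "W \<subseteq> {x + a, x + b}"
proof -
  define w where "w = Max W"
  have w: "w \<in> W" "v \<in> W \<Longrightarrow> v \<le> w" for v using assms(1,2) by (auto simp: w_def)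
  obtain x where x: "x \<in> X" "x \<le> w" "w \<le> x + m" using prevX[of w] w(1) assms(3) by auto
  have "x \<noteq> w" using x(1) w(1) assms(3) disj by auto
  then have "x < k" using assms(4)[OF x(1) w(1)] x(2) by (meson linorder_not_less order.not_eq_order_implies_strict)
  moreover have "W \<subseteq> {x + a, x + b}"
  proof
    fix v assume v: "v \<in> W"
    then show "v \<in> {x + a, x + b}" using XZ[OF x(1), of v] w(2)[OF v] assms(3) assms(5)[OF v] x \<open>x < k\<close> by auto
  qed
  ultimately show thesis using that x(1) by blast
qed

lemma close_holes_marks:
  assumes "b - a \<le> a" "z \<in> heads"
  shows "int (card {j \<in> {1..m}. z - j \<in> Z}) \<le> h"
proof (cases "Z \<inter> {z - m..<z} = {}")
  case True
  then show ?thesis by (intro offsets_le[of z 0 0]) auto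
next
  case False
  obtain x where "x \<in> X" "x < z - m" "Z \<inter> {z - m..<z} \<subseteq> {x + a, x + b}"
  proof (rule same_source[of "Z \<inter> {z - m..<z}" "z - m"])
    show "False" if "x \<in> X" "w \<in> Z \<inter> {z - m..<z}" "z - m \<le> x" "x < w" for x w
      using close_holes_order[OF assms that(1), of w] that by auto
  qed (use False in auto)
  then show ?thesis by (intro offsets_le[of z "x + a" "x + b"]) auto
qed

text \<open>Among three heads in one window, an element of \<open>X\<close> lies between the first
  two. It precedes the second head inside the window of the third, against
  \<open>close_holes_order\<close>.\<close>

lemma close_holes_bound:
  assumes "b - a \<le> a"
  shows "(m - 2 * h) * cnt n heads \<le> 2 * cnt n free"
proof (rule windows)
  show "int (card {j \<in> {1..m}. d + j \<in> heads}) \<le> 2" for d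
  proof (rule count_le_2)
    fix z1 z2 z3 assume z: "z1 \<in> heads" "z2 \<in> heads" "z3 \<in> heads" "z1 < z2" "z2 < z3" "z3 < z1 + m"
    obtain e where e: "e \<in> X" "z1 < e" "e < z2" using heads_before[OF heads_in_Z[OF z(1)] z(2,4)] by blast
    show False using close_holes_order[OF assms z(3) e(1) heads_in_Z[OF z(2)]] e z by auto
  qed
qed (rule close_holes_marks[OF assms])

lemma cnt_heads_le_free:
  assumes "2 \<le> a"
  shows "cnt n heads \<le> cnt n free"
proof -
  have "z - 1 \<in> free" if z: "z \<in> heads" for z
  proof -
    obtain e where e: "e \<in> X" "e = z - a \<or> e = z - b" "e < z"
    and et: "\<forall>t. e < t \<and> t < z \<longrightarrow> t \<notin> X \<and> t \<notin> Z"
    using heads_elim[OF z] by blast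
    have "e < z - 1" using e(2) assms ab by linarith
    then show ?thesis using et[THEN spec, of "z - 1"] by (simp add: free_iff)
  qed
  then have "heads \<subseteq> {x. x + (-1) \<in> free}" by auto
  from cnt_mono[OF this, of n] show ?thesis by (simp only: cnt_shift[OF n per_free])
qed

text \<open>The size of \<open>X\<close> gives a lower bound on the number of heads, so
  \<open>close_holes_bound\<close> leaves few values of \<open>m\<close>. For each of them it bounds
  the number of heads and thereby \<open>n\<close>.\<close>

lemma close_holes:
  assumes "b - a \<le> a"
  shows "n \<le> 32"
proof (cases "a = b")
  case True
  let ?t = "cnt n heads"
  have t: "5 \<le> ?t" "n \<le> m + 1 + 2 * ?t" using cntXZ X5 Z5 True n_eq cnt_free by auto
  have m4: "4 \<le> m" using m_ge True by auto
  have le: "(m - 2) * ?t \<le> 2 * (m + 1)" using close_holes_bound[OF assms] cnt_free True by simp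
  have "(m - 2) * 5 \<le> (m - 2) * ?t" using t(1) m4 by (intro mult_left_mono) auto
  from order_trans[OF this le] have "m \<le> 4" by (simp add: algebra_simps)
  then have "m = 4" using m4 by simp
  then show ?thesis using t le by simp
next
  case False
  let ?t = "cnt n heads"
  have t: "3 \<le> ?t" "n \<le> m + 4 * ?t" using cntXZ X5 Z5 False n_eq cnt_free by auto
  have m5: "5 \<le> m" using m_ge False by auto
  have le: "(m - 4) * ?t \<le> 2 * m" using close_holes_bound[OF assms] cnt_free False by simp
  have "(m - 4) * 3 \<le> (m - 4) * ?t" using t(1) m5 by (intro mult_left_mono) auto
  from order_trans[OF this le] have "m \<le> 12" by (simp add: algebra_simps)
  have a2: "2 \<le> a" using assms m5 ref by linarith
  \<comment> \<open>This matters for \<open>m = 5\<close>, where \<open>le\<close> alone would allow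
    ten heads.\<close>
  have tm: "?t \<le> m" using cnt_heads_le_free[OF a2] cnt_free False by auto
  consider "m = 5" | "m = 6" | "m = 7" | "m = 8" | "m = 9" | "m = 10" | "m = 11" | "m = 12"
    using m5 \<open>m \<le> 12\<close> by linarith
  then show ?thesis using le t tm by cases simp_all
qed

text \<open>Only \<open>z - a\<close> and \<open>z - b\<close> can lie in \<open>X\<close> in the
  window, which is split at \<open>z - b\<close>. Below \<open>z - b\<close> there is at most one
  element of \<open>Z\<close>; above it only \<open>z - b + a\<close>, if
  \<open>z - b \<in> X\<close>. If \<open>z - b \<notin> X\<close>, no element of \<open>X\<close>
  in the window precedes one of \<open>Z\<close>, and \<open>same_source\<close> applies to the
  whole window.\<close>

lemma distant_holes_marks:
  assumes "a < b - a" "z \<in> heads"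
  shows "int (card {j \<in> {1..m}. z - j \<in> Z}) \<le> h"
proof -
  obtain e where e: "e \<in> X" "e = z - a \<or> e = z - b" "e < z"
    and et: "\<forall>t. e < t \<and> t < z \<longrightarrow> t \<notin> X \<and> t \<notin> Z"
    using heads_elim[OF assms(2)] by blast
  have we: "w < e" if "w \<in> Z" "w < z" for w
    using et[THEN spec, of w] e(1) that disj by (cases w e rule: linorder_cases) auto
  have Xz: "x = z - a \<or> x = z - b" if "x \<in> X" "z - m \<le> x" "x < z" for x
    using XZ[OF that(1) heads_in_Z[OF assms(2)]] that by auto
  let ?W = "Z \<inter> {z - m..<z - b}"
  obtain p where p: "?W \<subseteq> {p}"
  proof (cases "?W = {}")
    case False
    obtain x where x: "x \<in> X" "x < z - m" "?W \<subseteq> {x + a, x + b}"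
    proof (rule same_source[of ?W "z - m"])
      show "False" if "x \<in> X" "w \<in> ?W" "z - m \<le> x" "x < w" for x w
        using Xz[OF that(1,3)] that ab by auto
    qed (use False in auto)
    \<comment> \<open>The two candidates differ by \<open>b - a > a\<close>, while the interval has
      only \<open>m - b \<le> a\<close> integers.\<close>
    have "\<not> (x + a \<in> ?W \<and> x + b \<in> ?W)" using assms(1) ref by auto
    then show thesis using x(3) that by blast
  qed (use that in blast)
  show ?thesis
  proof (cases "z - b \<in> X")
    case True
    show ?thesis
    proof (rule offsets_le[of z p "z - b + a"])
      fix w assume w: "w \<in> Z" "z - m \<le> w" "w < z"
      show "w = p \<or> w = z - b + a"
      proof (cases "w < z - b")
        case True
        then show ?thesis using p w by auto
      next
        case False
        then show ?thesis using XZ[OF \<open>z - b \<in> X\<close> w(1)] w ab by auto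
      qed
    qed (use assms ab in auto)
  next
    case False
    show ?thesis
    proof (cases "Z \<inter> {z - m..<z} = {}")
      case True
      then show ?thesis by (intro offsets_le[of z 0 0]) auto
    next
      case ne: False
      obtain x where "x \<in> X" "x < z - m" "Z \<inter> {z - m..<z} \<subseteq> {x + a, x + b}"
      proof (rule same_source[of "Z \<inter> {z - m..<z}" "z - m"])
        show "False" if "x \<in> X" "w \<in> Z \<inter> {z - m..<z}" "z - m \<le> x" "x < w" for x w
        proof -
          have "x = z - a" using Xz[OF that(1,3)] that False by auto
          moreover have "e = z - a" using e(1,2) False by auto
          ultimately show False using we[of w] that by auto
        qed
      qed (use ne in auto)
      then show ?thesis by (intro offsets_le[of z "x + a" "x + b"]) auto
    qed
  qed
qed

text \<open>Consecutive heads are separated by elements of \<open>X\<close>, and the window of the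
  last head has only two, so at most three heads share a window. If \<open>m - b = 1\<close>,
  already three heads are impossible: the lower separating element would be \<open>z3 - b\<close>,
  which is not above the first head.\<close>

lemma distant_holes_bound:
  assumes "a < b - a"
  shows "(m - 4) * cnt n heads \<le> (if m - b = 1 then 2 else 3) * cnt n free"
proof -
  have "(m - 2 * h) * cnt n heads \<le> (if m - b = 1 then 2 else 3) * cnt n free"
  proof (rule windows)
    show "int (card {j \<in> {1..m}. d + j \<in> heads}) \<le> (if m - b = 1 then 2 else 3)" for d
    proof (cases "m - b = 1")
      case True
      have "int (card {j \<in> {1..m}. d + j \<in> heads}) \<le> 2"
      proof (rule count_le_2)
        fix z1 z2 z3 assume z: "z1 \<in> heads" "z2 \<in> heads" "z3 \<in> heads" "z1 < z2" "z2 < z3" "z3 < z1 + m"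
        obtain e2 where e2: "e2 \<in> X" "z1 < e2" "e2 < z2" using heads_before[OF heads_in_Z[OF z(1)] z(2,4)] by blast
        have "e2 = z3 - a \<or> e2 = z3 - b" using XZ[OF e2(1) heads_in_Z[OF z(3)]] e2 z by auto
        moreover obtain e3 where e3: "z2 < e3" "e3 = z3 - a \<or> e3 = z3 - b" using heads_before[OF heads_in_Z[OF z(2)] z(3,5)] by blast
        ultimately show False using e2 z True ab by auto
      qed
      then show ?thesis using True by simp
    next
      case False
      show ?thesis
      proof (rule ccontr)
        let ?A = "{j \<in> {1..m}. d + j \<in> heads}"
        assume "\<not> ?thesis"
        then have c4: "4 \<le> card ?A" using False by auto
        define k where "k = Max ?A"
        have fin: "finite ?A" by (rule finite_subset[of _ "{1..m}"]) auto
        have ne: "?A \<noteq> {}" using c4 by (metis card.empty not_numeral_le_zero)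
        have k: "k \<in> ?A" "j \<in> ?A \<Longrightarrow> j \<le> k" for j
          unfolding k_def by (rule Max_in[OF fin ne], rule Max_ge[OF fin])
        have "3 \<le> card (?A - {k})" using c4 k(1) fin by (simp add: card_Diff_singleton)
        then obtain i1 i2 i3 where i: "i1 \<in> ?A - {k}" "i2 \<in> ?A - {k}" "i3 \<in> ?A - {k}" "i1 < i2" "i2 < i3"
          by (rule ex_less3)
        have "i3 < k" using i(3) k(2)[of i3] by auto
        have heads: "d + i1 \<in> heads" "d + i2 \<in> heads" "d + i3 \<in> heads" "d + k \<in> heads" using i k by auto
        obtain e2 where e2: "e2 \<in> X" "d + i1 < e2" "e2 < d + i2" using heads_before[OF heads_in_Z[OF heads(1)] heads(2)] i by auto
        obtain e3 where e3: "e3 \<in> X" "d + i2 < e3" "e3 < d + i3" using heads_before[OF heads_in_Z[OF heads(2)] heads(3)] i by auto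
        obtain e4 where e4: "e4 \<in> X" "d + i3 < e4" "e4 < d + k" using heads_before[OF heads_in_Z[OF heads(3)] heads(4)] \<open>i3 < k\<close> by auto
        have "k \<le> m" "1 \<le> i1" using k(1) i(1) by auto
        then have "e = d + k - a \<or> e = d + k - b" if "e \<in> X" "d + i1 < e" "e < d + k" for e
          using XZ[OF that(1) heads_in_Z[OF heads(4)]] that by auto
        from this[OF e2(1)] this[OF e3(1)] this[OF e4(1)] show False using e2 e3 e4 i \<open>i3 < k\<close> by auto
      qed
    qed
  qed (rule distant_holes_marks[OF assms])
  then show ?thesis using assms ab by auto
qed

lemma twinX_gap: "x \<in> twinX \<Longrightarrow> x < t \<Longrightarrow> t < x + (b - a) \<Longrightarrow> t \<in> free"
proof -
  assume x: "x \<in> twinX" and t: "x < t" "t < x + (b - a)"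
  have xX: "x \<in> X" "x + b \<in> Z" "x + a \<notin> Z" using x by (auto simp: twinX_def)
  have "t \<notin> Z" using XZ[OF xX(1), of t] xX t ab by auto
  moreover have "t \<notin> X" using XZ[OF _ xX(2), of t] t ab by auto
  ultimately show ?thesis by (simp add: free_iff)
qed

lemma twinZ_gap: "x + (b - a) \<in> twinZ \<Longrightarrow> x < t \<Longrightarrow> t < x + (b - a) \<Longrightarrow> t \<in> free"
proof -
  assume x: "x + (b - a) \<in> twinZ" and t: "x < t" "t < x + (b - a)"
  have xX: "x + (b - a) \<in> Z" "x - a \<in> X" "x + (b - a) - a \<notin> X" using x by (auto simp: twinZ_def)
  have "t \<notin> Z" using XZ[OF xX(2), of t] t ab by auto
  moreover have "t \<notin> X" using XZ[OF _ xX(1), of t] xX t ab by auto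
  ultimately show ?thesis by (simp add: free_iff)
qed

text \<open>The \<open>b - a - 1\<close> integers between a twin and its partner are free. Two such
  stretches do not overlap, since the later would start inside the earlier, at an element of
  \<open>X\<close> or \<open>Z\<close>. The shift of \<open>twinZ\<close> makes \<open>?G\<close>
  the set of left ends of the stretches.\<close>

lemma cnt_twins:
  assumes "a < b"
  shows "(b - a - 1) * (cnt n twinX + cnt n twinZ) \<le> cnt n free"
proof -
  let ?G = "twinX \<union> {x. x + (b - a) \<in> twinZ}"
  have G: "x \<in> X \<or> x \<in> Z" if "x \<in> ?G" for x using that by (auto simp: twinX_def twinZ_def)
  have gap: "t \<in> free" if "x \<in> ?G" "x < t" "t < x + (b - a)" for x t
    using that twinX_gap twinZ_gap by blast
  have "(b - a - 1) * cnt n ?G \<le> 1 * cnt n free"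
  proof (rule cnt_double_count[OF n _ per_free, of _ "{- (b - a - 1)..-1}"])
    show "periodic n ?G" by (intro periodic_Un per_twinX periodic_shift per_twinZ)
    fix x assume x: "x \<in> ?G"
    have "{j \<in> {- (b - a - 1)..-1}. x - j \<in> free} = {- (b - a - 1)..-1}"
      using gap[OF x] by auto
    then show "b - a - 1 \<le> int (card {j \<in> {- (b - a - 1)..-1}. x - j \<in> free})" by simp
  next
    fix q assume "q \<in> free"
    have "i = j" if "i \<in> {- (b - a - 1)..-1}" "j \<in> {- (b - a - 1)..-1}" "q + i \<in> ?G" "q + j \<in> ?G" for i j
      using gap[OF that(3), of "q + j"] gap[OF that(4), of "q + i"] G[OF that(3)] G[OF that(4)] that(1,2)
      by (cases i j rule: linorder_cases) (auto simp: free_iff)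
    then show "int (card {j \<in> {- (b - a - 1)..-1}. q + j \<in> ?G}) \<le> 1"
      using card_le_Suc0_iff_eq[of "{j \<in> {- (b - a - 1)..-1}. q + j \<in> ?G}"] by fastforce
  qed auto
  moreover have "cnt n ?G = cnt n twinX + cnt n twinZ"
  proof -
    have "twinX \<inter> {x. x + (b - a) \<in> twinZ} = {}"
      using disj by (auto simp: twinX_def twinZ_def)
    then show ?thesis using cnt_Un cnt_shift[OF n per_twinZ, of "b - a"] by simp
  qed
  ultimately show ?thesis by simp
qed

text \<open>Each twin costs a long free stretch, so there are at most three and
  \<open>n \<le> m + 2 * ?t + 3\<close>. Then \<open>distant_holes_bound\<close> limits
  \<open>m\<close> and, on each range of \<open>m\<close>, the number of heads.\<close>

lemma distant_holes:
  assumes d: "a < b - a"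
  shows "n \<le> 32"
proof -
  let ?t = "cnt n heads" and ?s = "cnt n twinX + cnt n twinZ"
  have "a \<noteq> b" using d ab by auto
  then have m5: "5 \<le> m" and free: "cnt n free \<le> m" using m_ge cnt_free by auto
  \<comment> \<open>Both \<open>a\<close> and \<open>m - b\<close> are at most
    \<open>b - a - 1\<close>, and \<open>m\<close> is the sum of \<open>a\<close>,
    \<open>b - a\<close> and \<open>m - b\<close>. If \<open>a = 1\<close>, then
    \<open>m - b = 1\<close> and \<open>m \<ge> 5\<close> gives the first bound.\<close>
  have d3: "3 \<le> b - a" "m \<le> 3 * (b - a) - 2" using m5 d ref ab by auto
  have XZs: "cnt n X + cnt n Z \<le> 2 * ?t + ?s" using cntX cntZ by simp
  have s3: "?s \<le> 3"
  proof (rule ccontr)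
    assume "\<not> ?thesis"
    then have "(b - a - 1) * 4 \<le> (b - a - 1) * ?s" using d3 by (intro mult_left_mono) auto
    also have "\<dots> \<le> m" using cnt_twins free d ab by linarith
    finally show False using d3 by simp
  qed
  have t4: "4 \<le> ?t" using X5 Z5 XZs s3 by linarith
  have nt: "n \<le> m + 2 * ?t + 3" using n_eq XZs s3 free by linarith
  have m4: "(m - 4) * 4 \<le> (m - 4) * ?t" using t4 m5 by (intro mult_left_mono) auto
  show ?thesis
  proof (cases "m - b = 1")
    case True
    have le: "(m - 4) * ?t \<le> 2 * m" using distant_holes_bound[OF d] True free by simp
    from order_trans[OF m4 le] have "m \<le> 8" by (simp add: algebra_simps)
    then consider "m = 5" | "m = 6" | "m = 7" | "m = 8" using m5 by linarith
    then show ?thesis using le nt by cases simp_all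
  next
    case False
    have le: "(m - 4) * ?t \<le> 3 * m" using distant_holes_bound[OF d] False free by simp
    from order_trans[OF m4 le] have "m \<le> 16" by (simp add: algebra_simps)
    \<comment> \<open>Here \<open>m - b \<ge> 2\<close>, hence \<open>a \<ge> 2\<close> and
      \<open>b - a \<ge> 3\<close>.\<close>
    moreover have "7 \<le> m" using False d ref ab by linarith
    ultimately consider "m = 7" | "m = 8" | "m = 9" | "10 \<le> m" "m \<le> 12" | "13 \<le> m" "m \<le> 16" by linarith
    then show ?thesis
    proof cases
      case 4
      then have "6 * ?t \<le> (m - 4) * ?t" using t4 by (intro mult_right_mono) auto
      from order_trans[OF this le] show ?thesis using 4 nt by linarith
    next
      case 5
      then have "9 * ?t \<le> (m - 4) * ?t" using t4 by (intro mult_right_mono) auto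
      from order_trans[OF this le] show ?thesis using 5 nt by linarith
    qed (use le nt in simp_all)
  qed
qed

lemma n_le: "n \<le> 32"
  using close_holes distant_holes by fastforce

end

section \<open>Assembling the cases\<close>

text \<open>This is the desired bound on the length of a progression with difference 1: outside
  \<open>cnt n X + 2\<close> consecutive integers from \<open>f\<close> on, the period is
  empty.\<close>

definition confined :: "int \<Rightarrow> int set \<Rightarrow> bool" where
  "confined n X \<longleftrightarrow> (\<exists>f. X \<inter> {f + cnt n X + 2..<f + n} = {})"

lemma confined_reflect:
  assumes n: "0 < n" and per: "periodic n X" and con: "confined n {x. j - x \<in> X}"
  shows "confined n X"
proof -
  let ?c = "cnt n X"
  obtain f where f: "{x. j - x \<in> X} \<inter> {f + ?c + 2..<f + n} = {}"
    using con cnt_reflect[OF n per] by (auto simp: confined_def)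
  have "X \<inter> {(j - f - n - 1 - ?c) + ?c + 2..<(j - f - n - 1 - ?c) + n} = {}"
  proof (intro equals0I)
    fix x assume "x \<in> X \<inter> {(j - f - n - 1 - ?c) + ?c + 2..<(j - f - n - 1 - ?c) + n}"
    then have "j - x \<in> {x. j - x \<in> X} \<inter> {f + ?c + 2..<f + n}" by auto
    then show False using f by blast
  qed
  then show ?thesis unfolding confined_def by blast
qed

text \<open>The circle is cut at the empty window: the period of \<open>X\<close> starting at
  \<open>z\<close> ends below \<open>z + n - m\<close>, so adding \<open>Y\<close> does not leave
  that period. The sums avoid \<open>Z\<close>, which bounds their number, and \<open>narrow\<close>
  applies to this finite set.\<close>

lemma confined_of_gap:
  assumes n: "0 < n" and perX: "periodic n X" and perZ: "periodic n Z"
    and Y: "Y \<subseteq> {0..m}" "0 \<in> Y" "m \<in> Y"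
    and narrow: "\<And>X'. \<not> wide_summand X' Y m"
    and sep: "\<And>x y. x \<in> X \<Longrightarrow> y \<in> Y \<Longrightarrow> x + y \<notin> Z"
    and total: "n \<le> cnt n X + cnt n Z + int (card Y) + 1" and X5: "5 \<le> cnt n X"
    and z: "\<And>x. x \<in> X \<Longrightarrow> z - m \<le> x \<Longrightarrow> x \<le> z \<Longrightarrow> False"
  shows "confined n X"
proof -
  let ?c = "cnt n X"
  define X1 where "X1 = X \<inter> {z..<z + n}"
  have fin: "finite X1" by (simp add: X1_def)
  have card: "int (card X1) = ?c" using cnt_window[OF n perX] by (simp add: X1_def)
  have "X1 \<noteq> {}" using card X5 by auto
  have "sumset X1 Y \<subseteq> (- Z) \<inter> {z..<z + n}"
  proof
    fix s assume "s \<in> sumset X1 Y"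
    then obtain x y where s: "s = x + y" "x \<in> X1" "y \<in> Y" by (auto simp: sumset_def)
    have x: "x \<in> X" "z \<le> x" "x < z + n" using s by (auto simp: X1_def)
    have "x - n \<in> X" using periodicD[OF perX, of "x - n"] x by simp
    then have "x - n < z - m" using z[of "x - n"] x by force
    moreover have "0 \<le> y" "y \<le> m" using s(3) Y(1) by auto
    ultimately show "s \<in> (- Z) \<inter> {z..<z + n}" using s x sep by auto
  qed
  then have "card (sumset X1 Y) \<le> card ((- Z) \<inter> {z..<z + n})" by (intro card_mono) auto
  moreover have "int (card ((- Z) \<inter> {z..<z + n})) = n - cnt n Z"
    using cnt_window[OF n, of "- Z" z] cnt_Compl[OF n, of Z] perZ by (simp add: periodic_def)
  ultimately have "card (sumset X1 Y) \<le> card X1 + card Y + 1" using total card by linarith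
  then have "Max X1 - Min X1 \<le> int (card X1) + 1"
    using narrow[of X1] fin card X5 Y by (auto simp: wide_summand_def)
  then have "X1 \<subseteq> {Min X1..Min X1 + ?c + 1}" using card Min_le[OF fin] Max_ge[OF fin] by force
  have "X \<inter> {Min X1 + ?c + 2..<Min X1 + n} = {}"
  proof (intro equals0I)
    fix x assume x: "x \<in> X \<inter> {Min X1 + ?c + 2..<Min X1 + n}"
    have M: "z \<le> Min X1" using Min_in[OF fin \<open>X1 \<noteq> {}\<close>] by (simp add: X1_def)
    show False
    proof (cases "x < z + n")
      case True
      then have "x \<in> X1" using x M X5 by (auto simp: X1_def)
      then show False using \<open>X1 \<subseteq> _\<close> x by auto
    next
      case False
      have "x - n \<in> X" using periodicD[OF perX, of "x - n"] x by simp
      moreover have "x - n < Min X1" "Min X1 < z + n" using x Min_in[OF fin \<open>X1 \<noteq> {}\<close>] by (auto simp: X1_def)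
      ultimately have "x - n \<in> X1" using False by (auto simp: X1_def)
      then show False using \<open>x - n < Min X1\<close> Min_le[OF fin] by force
    qed
  qed
  then show ?thesis unfolding confined_def by blast
qed

text \<open>The middle one of five elements works. A window containing it either includes three of
  the five on one side, or lies in the short interval around \<open>Z\<close>, where at most two of
  its at least five positions are missing.\<close>

lemma confined_center:
  assumes n: "0 < n" and per: "periodic n Z" and con: "confined n Z" and Z5: "5 \<le> cnt n Z" and m: "4 \<le> m"
  obtains z where "z \<in> Z" "\<And>t. z - m \<le> t \<Longrightarrow> t \<le> z \<Longrightarrow> 3 \<le> card (Z \<inter> {t..t + m})"
proof -
  let ?c = "cnt n Z"
  obtain f where f: "Z \<inter> {f + ?c + 2..<f + n} = {}" using con by (auto simp: confined_def)
  let ?I = "{f..<f + ?c + 2}"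
  have "Z \<inter> {f..<f + n} \<subseteq> Z \<inter> ?I" using f by force
  then have "card (Z \<inter> {f..<f + n}) \<le> card (Z \<inter> ?I)" by (intro card_mono) auto
  then have c: "?c \<le> int (card (Z \<inter> ?I))" using cnt_window[OF n per, of f] by simp
  have "card (?I - Z) = card ?I - card (?I \<inter> Z)" by (rule card_Diff_subset_Int) simp
  then have holes: "card (?I - Z) \<le> 2" using c Z5 by (simp add: Int_commute)
  have "5 \<le> card (Z \<inter> ?I)" using c Z5 by linarith
  then obtain z1 z2 z z4 z5 where zs: "z1 \<in> Z \<inter> ?I" "z2 \<in> Z \<inter> ?I" "z \<in> Z \<inter> ?I" "z4 \<in> Z \<inter> ?I" "z5 \<in> Z \<inter> ?I"
    and lt: "z1 < z2" "z2 < z" "z < z4" "z4 < z5" by (rule ex_less5)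
  show thesis
  proof (rule that)
    show "z \<in> Z" using zs by simp
    fix t assume t: "z - m \<le> t" "t \<le> z"
    consider "t \<le> z1" | "z5 \<le> t + m" | "z1 < t" "t + m < z5" by linarith
    then show "3 \<le> card (Z \<inter> {t..t + m})"
    proof cases
      case 1
      have "card {z1, z2, z} \<le> card (Z \<inter> {t..t + m})" using 1 zs lt t by (intro card_mono) auto
      then show ?thesis using lt by simp
    next
      case 2
      have "card {z, z4, z5} \<le> card (Z \<inter> {t..t + m})" using 2 zs lt t by (intro card_mono) auto
      then show ?thesis using lt by simp
    next
      case 3
      have "{t..t + m} = (Z \<inter> {t..t + m}) \<union> ({t..t + m} - Z)" by auto
      then have "card {t..t + m} \<le> card (Z \<inter> {t..t + m}) + card ({t..t + m} - Z)" by (metis card_Un_le)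
      moreover have "card ({t..t + m} - Z) \<le> card (?I - Z)" using 3 zs by (intro card_mono) auto
      moreover have "card {t..t + m} = nat (m + 1)" by simp
      ultimately show ?thesis using holes m by linarith
    qed
  qed
qed

lemma confined_of_two_holes:
  assumes big: "32 < n" and perX: "periodic n X" and perZ: "periodic n Z"
    and ab: "0 < a" "a \<le> b" "b < m" and ref: "m - b \<le> a" and Y: "Y = {0..m} - {a, b}" and Y4: "4 \<le> card Y"
    and sep: "\<And>x y. x \<in> X \<Longrightarrow> y \<in> Y \<Longrightarrow> x + y \<notin> Z"
    and total: "n \<le> cnt n X + cnt n Z + int (card Y) + 1" and X5: "5 \<le> cnt n X" and Z5: "5 \<le> cnt n Z"
  shows "confined n X"
proof -
  have n0: "0 < n" using big by simp
  have narrow: "\<not> wide_summand X' Y m" for X'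
    using wide_holes.no_wide_holes[of X' Y m a b] ab ref Y Y4
    by (auto simp: wide_holes_def wide_holes_axioms_def)
  have Ym: "Y \<subseteq> {0..m}" "0 \<in> Y" "m \<in> Y" using Y ab by auto
  have cardY: "int (card Y) = m + 1 - (if a = b then 1 else 2)" unfolding Y using ab by (rule card_interval_holes)
  then have m4: "4 \<le> m" using Y4 by (auto split: if_splits)
  have XZ: "z = x + a \<or> z = x + b" if "x \<in> X" "z \<in> Z" "x \<le> z" "z \<le> x + m" for x z
    using sep[OF that(1), of "z - x"] that Y by auto
  have gap: "confined n X" if "\<And>x. x \<in> X \<Longrightarrow> z - m \<le> x \<Longrightarrow> x \<le> z \<Longrightarrow> False" for z
    using confined_of_gap[OF n0 perX perZ Ym narrow _ total X5, of z] sep that by blast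
  show ?thesis
  proof (cases "\<forall>z\<in>Z. \<exists>x\<in>X. x \<le> z \<and> z \<le> x + m")
    case False
    then obtain z where z: "\<And>x. x \<in> X \<Longrightarrow> z - m \<le> x \<Longrightarrow> x \<le> z \<Longrightarrow> False" by force
    show ?thesis by (rule gap[of z]) (rule z)
  next
    case prevX: True
    show ?thesis
    proof (cases "\<forall>x\<in>X. \<exists>z\<in>Z. x \<le> z \<and> z \<le> x + m")
      case nextZ: True
      interpret spread n m a b X Z
        by unfold_locales (use n0 perX perZ ab ref XZ nextZ prevX total cardY X5 Z5 Y4 in \<open>auto split: if_splits\<close>)
      show ?thesis using n_le big by simp
    next
      case False
      then obtain x0 where x0: "x0 \<in> X" "\<And>z. z \<in> Z \<Longrightarrow> x0 \<le> z \<Longrightarrow> z \<le> x0 + m \<Longrightarrow> False" by blast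
      \<comment> \<open>\<open>X + Y\<close> avoids \<open>Z\<close> exactly when
        \<open>-Z + Y\<close> avoids \<open>-X\<close>; the window without elements of
        \<open>-Z\<close> ends at \<open>- x0\<close>.\<close>
      have "confined n {t. 0 - t \<in> Z}"
      proof (rule confined_of_gap[OF n0 periodic_reflect[OF perZ] periodic_reflect[OF perX] Ym narrow])
        fix x y assume "x \<in> {t. 0 - t \<in> Z}" "y \<in> Y"
        then show "x + y \<notin> {t. 0 - t \<in> X}" using sep[of "0 - (x + y)" y] by auto
      next
        show "n \<le> cnt n {t. 0 - t \<in> Z} + cnt n {t. 0 - t \<in> X} + int (card Y) + 1"
          using total by (simp only: cnt_reflect[OF n0 perX] cnt_reflect[OF n0 perZ])
        show "5 \<le> cnt n {t. 0 - t \<in> Z}" using Z5 by (simp only: cnt_reflect[OF n0 perZ])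
        show False if "x \<in> {t. 0 - t \<in> Z}" "- x0 - m \<le> x" "x \<le> - x0" for x
          using x0(2)[of "- x"] that by auto
      qed
      then have "confined n Z" by (rule confined_reflect[OF n0 perZ])
      then obtain z where z: "z \<in> Z" "\<And>t. z - m \<le> t \<Longrightarrow> t \<le> z \<Longrightarrow> 3 \<le> card (Z \<inter> {t..t + m})"
        using confined_center[OF n0 perZ _ Z5 m4] by blast
      show ?thesis
      proof (rule gap[of z])
        fix x assume x: "x \<in> X" "z - m \<le> x" "x \<le> z"
        have "Z \<inter> {x..x + m} \<subseteq> {x + a, x + b}"
        proof
          fix w assume "w \<in> Z \<inter> {x..x + m}"
          then show "w \<in> {x + a, x + b}" using XZ[OF x(1), of w] by auto
        qed
        then have "card (Z \<inter> {x..x + m}) \<le> card {x + a, x + b}" by (intro card_mono) auto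
        also have "\<dots> \<le> 2" by (simp add: card_insert_if)
        finally show False using z(2)[OF x(2,3)] by simp
      qed
    qed
  qed
qed

text \<open>The length of \<open>Y\<close> leaves at most two holes, all interior. If they have the
  wrong orientation, the reflected sets \<open>-X\<close>, \<open>m - Y\<close>,
  \<open>m - Z\<close> are used instead.\<close>

lemma confined_of_summand:
  assumes n: "32 < n" and perX: "periodic n X" and perZ: "periodic n Z"
    and Ysub: "Y \<subseteq> {0..m}" "0 \<in> Y" "m \<in> Y" and Y4: "4 \<le> card Y" and short: "m \<le> int (card Y) + 1"
    and sep: "\<And>x y. x \<in> X \<Longrightarrow> y \<in> Y \<Longrightarrow> x + y \<notin> Z"
    and total: "n \<le> cnt n X + cnt n Z + int (card Y) + 1" and X5: "5 \<le> cnt n X" and Z5: "5 \<le> cnt n Z"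
  shows "confined n X"
proof -
  have n0: "0 < n" using n by simp
  define H where "H = {0..m} - Y"
  have finY: "finite Y" using Ysub finite_subset by blast
  have Yeq: "Y = {0..m} - H" using Ysub by (auto simp: H_def)
  have "card Y \<le> card {0..m}" using Ysub by (intro card_mono) auto
  moreover have "card H = card {0..m} - card Y" unfolding H_def using Ysub finY by (intro card_Diff_subset) auto
  moreover have "card {0..m} = nat (m + 1)" by simp
  ultimately have m3: "3 \<le> m" and H2: "card H \<le> 2" using Y4 short by linarith+
  have H_in: "0 < j \<and> j < m" if "j \<in> H" for j using that Ysub(2,3) by (auto simp: H_def less_le)
  show ?thesis
  proof (cases "H = {}")
    case True
    have Yfull: "Y = {0..m}" using Yeq True by simp
    \<comment> \<open>Without holes the window before any element of \<open>Z\<close> misses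
      \<open>X\<close>.\<close>
    have "Z \<noteq> {}" using Z5 by (auto simp: cnt_def)
    then obtain z where z: "z \<in> Z" by blast
    show ?thesis
    proof (rule confined_of_gap[OF n0 perX perZ Ysub _ sep total X5])
      show "\<not> wide_summand X' Y m" for X' using no_wide_full[OF _ m3] Yfull by blast
      show False if "x \<in> X" "z - m \<le> x" "x \<le> z" for x
        using sep[OF that(1), of "z - x"] that Yfull z by auto
    qed
  next
    case False
    obtain a b where Hab: "H = {a, b}" "a \<le> b"
    proof -
      have "card H \<noteq> 0" using False by (simp add: H_def)
      then consider "card H = 1" | "card H = 2" using H2 by linarith
      then show thesis
      proof cases
        case 1 then show thesis using that by (auto simp: card_1_singleton_iff)
      next
        case 2
        then obtain u v where "H = {u, v}" by (auto simp: card_2_iff)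
        then show thesis using that[of u v] that[of v u] by (cases "u \<le> v") auto
      qed
    qed
    have ab: "0 < a" "a \<le> b" "b < m" using H_in Hab by auto
    have Yab: "Y = {0..m} - {a, b}" using Yeq Hab by simp
    show ?thesis
    proof (cases "m - b \<le> a")
      case True
      then show ?thesis using confined_of_two_holes[OF n perX perZ ab _ Yab Y4 sep total X5 Z5] by blast
    next
      case False
      let ?Y = "{0..m} - {m - b, m - a}"
      have "?Y = (\<lambda>y. m - y) ` Y"
      proof (intro equalityI subsetI)
        fix x assume "x \<in> ?Y"
        then have "m - x \<in> Y" by (auto simp: Yab)
        then show "x \<in> (\<lambda>y. m - y) ` Y" by (intro image_eqI[of _ _ "m - x"]) auto
      qed (auto simp: Yab)
      then have cY: "card ?Y = card Y" by (simp add: card_image inj_on_def)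
      have "confined n {t. 0 - t \<in> X}"
      proof (rule confined_of_two_holes[OF n periodic_reflect[OF perX] periodic_reflect[OF perZ], of "m - b" "m - a" m ?Y])
        fix x y assume xy: "x \<in> {t. 0 - t \<in> X}" "y \<in> ?Y"
        then have "m - y \<in> Y" using Yab by auto
        then have "(0 - x) + (m - y) \<notin> Z" using sep xy by blast
        then show "x + y \<notin> {t. m - t \<in> Z}" by (simp add: algebra_simps)
      next
        show "n \<le> cnt n {t. 0 - t \<in> X} + cnt n {t. m - t \<in> Z} + int (card ?Y) + 1"
          using total by (simp only: cnt_reflect[OF n0 perX] cnt_reflect[OF n0 perZ] cY)
        show "5 \<le> cnt n {t. 0 - t \<in> X}" "5 \<le> cnt n {t. m - t \<in> Z}"
          using X5 Z5 by (simp_all only: cnt_reflect[OF n0 perX] cnt_reflect[OF n0 perZ])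
        show "4 \<le> card ?Y" using Y4 cY by simp
      qed (use ab False in auto)
      then show ?thesis by (rule confined_reflect[OF n0 perX])
    qed
  qed
qed

section \<open>Residue rings\<close>

lemma add_pow_residue_ring:
  fixes i :: nat
  assumes "1 < n"
  shows "[i] \<cdot>\<^bsub>residue_ring n\<^esub> \<one>\<^bsub>residue_ring n\<^esub> = int i mod n"
proof (induction i)
  case 0
  then show ?case by (simp add: add_pow_def nat_pow_def residue_ring_def)
next
  case (Suc i)
  have "[Suc i] \<cdot>\<^bsub>residue_ring n\<^esub> \<one>\<^bsub>residue_ring n\<^esub>
      = ([i] \<cdot>\<^bsub>residue_ring n\<^esub> \<one>\<^bsub>residue_ring n\<^esub>) \<oplus>\<^bsub>residue_ring n\<^esub> \<one>\<^bsub>residue_ring n\<^esub>"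
    by (simp add: add_pow_def nat_pow_def)
  also have "\<dots> = (int i mod n + 1) mod n" unfolding Suc by (simp add: residue_ring_def)
  finally show ?case by (simp add: mod_add_right_eq add.commute)
qed

lemma arith_prog_one:
  assumes "1 < n"
  shows "arith_prog (residue_ring n) a \<one>\<^bsub>residue_ring n\<^esub> k = (\<lambda>i. (a + i) mod n) ` {0..<int k}"
proof -
  have *: "a \<oplus>\<^bsub>residue_ring n\<^esub> ([i] \<cdot>\<^bsub>residue_ring n\<^esub> \<one>\<^bsub>residue_ring n\<^esub>) = (a + int i) mod n" for i :: nat
    unfolding add_pow_residue_ring[OF assms] by (simp add: residue_ring_def mod_add_right_eq)
  have "arith_prog (residue_ring n) a \<one>\<^bsub>residue_ring n\<^esub> k = (\<lambda>i. (a + int i) mod n) ` {0..<k}"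
    unfolding arith_prog_def * by auto
  also have "\<dots> = (\<lambda>i. (a + i) mod n) ` (int ` {0..<k})" by (simp add: image_image)
  finally show ?thesis by (simp add: image_int_atLeastLessThan)
qed

lemma inj_on_residue:
  fixes a n k :: int
  assumes "k \<le> n"
  shows "inj_on (\<lambda>i. (a + i) mod n) {0..<k}"
proof (rule inj_onI)
  fix i j assume ij: "i \<in> {0..<k}" "j \<in> {0..<k}" "(a + i) mod n = (a + j) mod n"
  have "(a + i - a) mod n = (a + j - a) mod n" using ij(3) by (metis mod_diff_left_eq)
  then show "i = j" using ij(1,2) assms by simp
qed

lemma set_add_residue_ring:
  "A <+>\<^bsub>residue_ring n\<^esub> B = {(x + y) mod n | x y. x \<in> A \<and> y \<in> B}"
  by (auto simp: set_add_def' residue_ring_def)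

theorem theorem3p2:
  fixes p :: nat and X Y :: "int set"
  defines "R \<equiv> residue_ring (int p)"
  assumes "prime p" and "p > 32"
    and "X \<subseteq> carrier R" and "Y \<subseteq> carrier R"
    and "card (X <+>\<^bsub>R\<^esub> Y) = card X + card Y + 1"
    and "card X + card Y + 1 \<le> p - 5"
    and "card Y \<ge> 4" and "card X \<ge> 5"
    and "ap_len R \<one>\<^bsub>R\<^esub> Y \<le> card Y + 2"
  shows "ap_len R \<one>\<^bsub>R\<^esub> X \<le> card X + 2"
proof -
  define n where "n = int p"
  have n: "32 < n" "0 < n" "1 < n" using \<open>p > 32\<close> by (auto simp: n_def)
  have X: "X \<subseteq> {0..<n}" and Y: "Y \<subseteq> {0..<n}"
    using assms(4,5) by (auto simp: R_def residue_ring_def n_def)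
  have prog: "arith_prog R a \<one>\<^bsub>R\<^esub> k = (\<lambda>i. (a + i) mod n) ` {0..<int k}" for a k
    using arith_prog_one[OF n(3)] by (simp add: R_def n_def)
  have carrier: "carrier R = {0..<n}" by (auto simp: R_def residue_ring_def n_def)
  define S where "S = X <+>\<^bsub>R\<^esub> Y"
  have S: "S = {(x + y) mod n | x y. x \<in> X \<and> y \<in> Y}"
    unfolding S_def R_def set_add_residue_ring n_def ..
  have cardS: "int (card S) = int (card X) + int (card Y) + 1" using assms(6) by (simp add: S_def)
  have room: "int (card X) + int (card Y) + 6 \<le> n" using assms(7) \<open>p > 32\<close> by (simp add: n_def)

  \<comment> \<open>All residues form a progression, so the minimum in \<open>ap_len\<close> is
    attained.\<close>
  have "Y \<subseteq> arith_prog R 0 \<one>\<^bsub>R\<^esub> p"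
  proof
    fix y assume "y \<in> Y"
    then have "y \<in> {0..<n}" using Y by blast
    then show "y \<in> arith_prog R 0 \<one>\<^bsub>R\<^esub> p" unfolding prog n_def[symmetric] by (intro image_eqI[of _ _ y]) auto
  qed
  moreover have "0 \<in> carrier R" using n carrier by simp
  ultimately have "\<exists>l. \<exists>a\<in>carrier R. \<exists>k. Y \<subseteq> arith_prog R a \<one>\<^bsub>R\<^esub> k \<and> card (arith_prog R a \<one>\<^bsub>R\<^esub> k) = l"
    by blast
  from LeastI_ex[OF this] obtain a k where "a \<in> carrier R" and Yprog: "Y \<subseteq> arith_prog R a \<one>\<^bsub>R\<^esub> k"
    and "card (arith_prog R a \<one>\<^bsub>R\<^esub> k) = ap_len R \<one>\<^bsub>R\<^esub> Y"
    unfolding ap_len_def by blast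
  then have prog_le: "card (arith_prog R a \<one>\<^bsub>R\<^esub> k) \<le> card Y + 2" using assms(10) by simp
  \<comment> \<open>The hypothesis bounds the cardinality of the progression, not its number of
    terms. As \<open>card Y + 2 < n\<close>, the progression does not wrap around and the two
    agree.\<close>
  have k: "int k \<le> int (card Y) + 2"
  proof -
    let ?j = "min (int k) n"
    have "card ((\<lambda>i. (a + i) mod n) ` {0..<?j}) \<le> card ((\<lambda>i. (a + i) mod n) ` {0..<int k})"
      by (intro card_mono image_mono) auto
    moreover have "card ((\<lambda>i. (a + i) mod n) ` {0..<?j}) = card {0..<?j}"
      by (intro card_image inj_on_residue) simp
    ultimately have "?j \<le> int (card Y) + 2" using prog_le n by (simp add: prog)
    then show ?thesis using room by linarith
  qed
  then have kn: "int k \<le> n" using room by linarith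
  define I where "I = {i \<in> {0..<int k}. (a + i) mod n \<in> Y}"
  have finI: "finite I" by (rule finite_subset[of _ "{0..<int k}"]) (auto simp: I_def)
  have "(\<lambda>i. (a + i) mod n) ` I = Y" using Yprog by (auto simp: prog I_def)
  moreover have "inj_on (\<lambda>i. (a + i) mod n) I"
    by (rule inj_on_subset[OF inj_on_residue[OF kn]]) (auto simp: I_def)
  ultimately have cardI: "card I = card Y" using card_image by metis
  then have I_ne: "I \<noteq> {}" using assms(8) by auto
  define lo m where "lo = Min I" and "m = Max I - Min I"
  define Y' where "Y' = (\<lambda>i. i - lo) ` I"
  have cardY': "card Y' = card Y" unfolding Y'_def cardI[symmetric] by (intro card_image) auto
  have Y': "Y' \<subseteq> {0..m}" "0 \<in> Y'" "m \<in> Y'"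
    using finI I_ne Min_in[OF finI I_ne] Max_in[OF finI I_ne] by (auto simp: Y'_def lo_def m_def)
  have "Min I \<in> I" "Max I \<in> I" using Min_in[OF finI I_ne] Max_in[OF finI I_ne] by auto
  then have m: "m \<le> int (card Y') + 1" using k cardY' by (auto simp: m_def I_def)

  define X' where "X' = {x. x mod n \<in> X}"
  \<comment> \<open>The complement of the sumset, shifted by \<open>a + lo\<close> to match the
    translation from \<open>Y\<close> to \<open>Y'\<close>.\<close>
  define Z where "Z = {z. (z + (a + lo)) mod n \<notin> S}"
  have perX: "periodic n X'" by (intro periodicI) (simp add: X'_def)
  have perS: "periodic n {z. z mod n \<notin> S}" by (intro periodicI) simp
  have Z_shift: "Z = {z. z + (a + lo) \<in> {z. z mod n \<notin> S}}" by (simp add: Z_def)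
  have perZ: "periodic n Z" unfolding Z_shift by (rule periodic_shift[OF perS])
  have "X' \<inter> {0..<n} = X" using X by (auto simp: X'_def)
  then have cntX: "cnt n X' = int (card X)" by (simp add: cnt_def)
  have "S \<subseteq> {0..<n}" using n by (auto simp: S)
  then have "{z. z mod n \<in> S} \<inter> {0..<n} = S" by auto
  then have "cnt n {z. z mod n \<in> S} = int (card S)" by (simp add: cnt_def)
  moreover have "{z. z mod n \<notin> S} = - {z. z mod n \<in> S}" by auto
  ultimately have cntZ: "cnt n Z = n - int (card S)"
    unfolding Z_shift cnt_shift[OF n(2) perS] by (simp add: cnt_Compl[OF n(2)])
  have "confined n X'"
  proof (rule confined_of_summand[OF n(1) perX perZ Y'])
    show "4 \<le> card Y'" using assms(8) cardY' by simp
    show "m \<le> int (card Y') + 1" by (rule m)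
    show "n \<le> cnt n X' + cnt n Z + int (card Y') + 1" using cntX cntZ cardS cardY' by simp
    show "5 \<le> cnt n X'" using cntX assms(9) by simp
    \<comment> \<open>The bound \<open>p - 5\<close> on the sumset leaves five elements in its
      complement.\<close>
    show "5 \<le> cnt n Z" using cntZ cardS room by simp
    fix x y assume x: "x \<in> X'" and "y \<in> Y'"
    then obtain i where i: "i \<in> I" "y = i - lo" by (auto simp: Y'_def)
    have "(x mod n + (a + i) mod n) mod n \<in> S" using x i(1) by (auto simp: S X'_def I_def)
    then have "(x + y + (a + lo)) mod n \<in> S" by (simp add: i(2) mod_add_eq add.commute add.left_commute)
    then show "x + y \<notin> Z" by (simp add: Z_def)
  qed
  then obtain f where f: "X' \<inter> {f + int (card X) + 2..<f + n} = {}" by (auto simp: confined_def cntX)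
  let ?P = "arith_prog R (f mod n) \<one>\<^bsub>R\<^esub> (card X + 2)"
  have "X \<subseteq> ?P"
  proof
    fix x assume x: "x \<in> X"
    define i where "i = (x - f) mod n"
    have i: "0 \<le> i" "i < n" using n by (auto simp: i_def)
    have "(f + i) mod n = x mod n" by (simp add: i_def mod_add_right_eq)
    moreover have "x mod n = x" using x X by auto
    ultimately have fi: "(f + i) mod n = x" by simp
    then have "f + i \<in> X'" using x by (simp add: X'_def)
    then have "i < int (card X + 2)" using f i by force
    moreover have "(f mod n + i) mod n = x" using fi by (simp add: mod_add_left_eq)
    ultimately show "x \<in> ?P" unfolding prog using i by (intro image_eqI[of _ _ i]) auto
  qed
  moreover have "f mod n \<in> carrier R" using n carrier by simp
  ultimately have "ap_len R \<one>\<^bsub>R\<^esub> X \<le> card ?P" unfolding ap_len_def by (intro Least_le) blast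
  also have "\<dots> \<le> card X + 2" unfolding prog by (rule order_trans[OF card_image_le]) auto
  finally show ?thesis .
qed

end
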